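(* Let $(X,\pi;M_X,I_X)$ and $(Y,\sigma;M_Y,I_Y)$ be impulsive semidynamical systems satisfying the standing assumptions. Let $x\in X$ be asymptotically almost $\tilde\pi$-periodic and such that $\overline{\tilde\pi^+(x)}$ is compact. A point $y\in Y$ is comparable in limit with $x$ if and only if there is a continuous mapping $h:\tilde L_X^+(x)\to\tilde L_Y^+(y)$ satisfying the conditions: (a) $\mathcal L_{x,q}^{+\infty}\subset\mathcal L_{y,h(q)}^{+\infty}$ for all $q\in\tilde L_X^+(x)$; (b) $h(\tilde\pi(q,t))=\tilde\sigma(h(q),t)$ for all $q\in\tilde L_X^+(x)\setminus M_X$ and $t\in\mathbb R_+$; (c) for $\tilde q\in\mathcal P_x\setminus M_X$ we have $$\lim_{t\to+\infty}\rho_Y\big(\tilde\sigma(y,t),\tilde\sigma(h(\tilde q),g_{\tilde q}^x(t))\big)=0.$$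
   Context: Let $\mathbb R_+=[0,+\infty)$. A semidynamical system $(Z,\varrho)$ on a metric space $Z$ is a continuous map $\varrho:Z\times\mathbb R_+\to Z$ with $\varrho(z,0)=z$ and $\varrho(\varrho(z,t),s)=\varrho(z,t+s)$ for all $z\in Z$, $t,s\in\mathbb R_+$. For $z\in Z$, $t\ge 0$ put $F(z,t)=\{w\in Z:\varrho(w,t)=z\}$; for $D\subset Z$, $\Delta\subset[0,+\infty)$ put $F(D,\Delta)=\bigcup_{z\in D,\,t\in\Delta}F(z,t)$ (singletons are written without braces). A point $z$ is an initial point if $F(z,t)=\emptyset$ for all $t>0$. An impulsive semidynamical system (ISS) $(Z,\varrho;M,I)$ consists of a semidynamical system $(Z,\varrho)$, a nonempty closed set $M\subset Z$ such that for every $z\in M$ there is $\epsilon_z>0$ with $F(z,(0,\epsilon_z))\cap M=\emptyset$ and $\varrho(z,(0,\epsilon_z))\cap M=\emptyset$, and a continuous function $I:M\to Z$. Let $\phi(z)\in(0,+\infty]$ be the least $s>0$ with $\varrho(z,s)\in M$, and $\phi(z)=+\infty$ if no such $s$ exists. The impulsive trajectory $\tilde\varrho(z,\cdot)$ of $z$ is defined inductively: $z_0^+=z$, $t_0=0$; given $z_n^+$ and $t_n$, if $\phi(z_n^+)=+\infty$ then $\tilde\varrho(z,t)=\varrho(z_n^+,t-t_n)$ for all $t\ge t_n$; otherwise let $s_n=\phi(z_n^+)$, $t_{n+1}=t_n+s_n$, $\tilde\varrho(z,t)=\varrho(z_n^+,t-t_n)$ for $t_n\le t<t_{n+1}$,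 $z_{n+1}=\varrho(z_n^+,s_n)\in M$, $z_{n+1}^+=I(z_{n+1})$, and $\tilde\varrho(z,t_{n+1})=z_{n+1}^+$. Strong Tube Condition (STC): a point $z\in M$ satisfies STC if there are $\lambda>0$ and closed sets $S,L\subset Z$ with $z\in S$ such that $F(L,\lambda)=S$; $F(L,[0,2\lambda])$ is a neighborhood of $z$; $F(L,\mu)\cap F(L,\nu)=\emptyset$ for $0\le\mu<\nu\le 2\lambda$; and $S=M\cap F(L,[0,2\lambda])$. Standing assumptions on every ISS: no initial point of $(Z,\varrho)$ belongs to $M$ and every element of $M$ satisfies STC (consequently $\phi$ is continuous on $Z\setminus M$); $M\cap I(M)=\emptyset$; and $\tilde\varrho(z,t)$ is defined for all $t\ge 0$ and all $z\in Z$. Here $(X,\rho_X)$ and $(Y,\rho_Y)$ are metric spaces, and $\tilde\pi,\tilde\sigma$ denote the impulsive trajectories in $(X,\pi;M_X,I_X)$ and $(Y,\sigma;M_Y,I_Y)$. The impulsive positive orbit is $\tilde\pi^+(x)=\{\tilde\pi(x,t):t\ge0\}$; the overline denotes closure. The positive limit set $\tilde L_X^+(x)$ is the set of all $q\in X$ for which there is a sequence $\lambda_n\to+\infty$ in $\mathbb R_+$ with $\tilde\pi(x,\lambda_n)\to q$; $\tilde L_Y^+(y)$ is defined analogously with $\tilde\sigma$. A point $p\in X$ is almost $\tilde\pi$-periodic if for every $\epsilon>0$ there is $T=T(\epsilon)>0$ such that for every $\alpha\ge0$ the interval $[\alpha,\alpha+T]$ contains a number $\tau_\alpha>0$ with $\rho_X(\tilde\pi(p,t+\tau_\alpha),\tilde\pi(p,t))<\epsilon$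 for all $t\ge0$. A time reparametrization is a homeomorphism $g:\mathbb R_+\to\mathbb R_+$ with $g(0)=0$. A point $x\in X$ is asymptotically almost $\tilde\pi$-periodic if there are an almost $\tilde\pi$-periodic point $p\in X$ and a time reparametrization $g_p$ with $\lim_{t\to+\infty}\rho_X(\tilde\pi(x,t),\tilde\pi(p,g_p(t)))=0$. $\mathcal P_x$ is the set of all $z\in\tilde L_X^+(x)\cap\tilde L_X^+(z)$ for which there is a time reparametrization $g_z$ with $\lim_{t\to+\infty}\rho_X(\tilde\pi(x,t),\tilde\pi(z,g_z(t)))=0$. For each $z\in\mathcal P_x$, $g_z^x$ denotes such a time reparametrization (fixed, arbitrarily chosen). For a system $(Z,\varrho;M,I)$ and $z,p\in Z$: $\mathcal L_{z,p}^{+\infty}$ is the set of sequences $\{t_n\}_{n\in\mathbb N}\subset\mathbb R_+$ with $t_n\to+\infty$ and $\tilde\varrho(z,t_n)\to p$; $\mathcal L_z^{+\infty}=\bigcup_{p\in Z}\mathcal L_{z,p}^{+\infty}$. A point $y\in Y$ is comparable in limit with $x\in X$ if $\mathcal L_x^{+\infty}\subset\mathcal L_y^{+\infty}$. *)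

theory Defs
  imports "HOL-Analysis.Analysis"
begin

text \<open>
  Metric spaces are types of class \<^class>\<open>metric_space\<close>. A semidynamical system is a map
  \<open>\<rho> :: 'z \<Rightarrow> real \<Rightarrow> 'z\<close>; only its values at nonnegative times are constrained or used.
  Likewise an impulse map \<open>I :: 'z \<Rightarrow> 'z\<close> matters only on the impulsive set \<open>M\<close>.
\<close>

locale semidynamical_system =
  fixes \<rho> :: "'z::metric_space \<Rightarrow> real \<Rightarrow> 'z"
  assumes cont: "continuous_on (UNIV \<times> {0..}) (\<lambda>(z, t). \<rho> z t)"
    and zero: "\<rho> z 0 = z"
    and add: "t \<ge> 0 \<Longrightarrow> s \<ge> 0 \<Longrightarrow> \<rho> (\<rho> z t) s = \<rho> z (t + s)"

definition past :: "('z \<Rightarrow> real \<Rightarrow> 'z) \<Rightarrow> 'z \<Rightarrow> real \<Rightarrow> 'z set"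
  where "past \<rho> z t = {w. \<rho> w t = z}"

definition past_set :: "('z \<Rightarrow> real \<Rightarrow> 'z) \<Rightarrow> 'z set \<Rightarrow> real set \<Rightarrow> 'z set"
  where "past_set \<rho> D \<Delta> = (\<Union>z\<in>D. \<Union>t\<in>\<Delta>. past \<rho> z t)"

definition initial_point :: "('z \<Rightarrow> real \<Rightarrow> 'z) \<Rightarrow> 'z \<Rightarrow> bool"
  where "initial_point \<rho> z \<longleftrightarrow> (\<forall>t>0. past \<rho> z t = {})"

definition satisfies_STC ::
    "('z::metric_space \<Rightarrow> real \<Rightarrow> 'z) \<Rightarrow> 'z set \<Rightarrow> 'z \<Rightarrow> bool"
  where "satisfies_STC \<rho> M z \<longleftrightarrow>
    (\<exists>\<kappa>>0. \<exists>S L. closed S \<and> closed L \<and> z \<in> S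
       \<and> past_set \<rho> L {\<kappa>} = S
       \<and> z \<in> interior (past_set \<rho> L {0..2 * \<kappa>})
       \<and> (\<forall>\<mu> \<nu>. 0 \<le> \<mu> \<and> \<mu> < \<nu> \<and> \<nu> \<le> 2 * \<kappa> \<longrightarrow>
             past_set \<rho> L {\<mu>} \<inter> past_set \<rho> L {\<nu>} = {})
       \<and> S = M \<inter> past_set \<rho> L {0..2 * \<kappa>})"

text \<open>
  For an impulsive semidynamical system (locale below) the set of hitting times
  \<open>{s. s > 0 \<and> \<rho> z s \<in> M}\<close> has a least element whenever it is nonempty: \<open>M\<close> is closed,
  and points of \<open>M\<close> do not return to \<open>M\<close> immediately.
\<close>

definition hit_time ::
    "('z \<Rightarrow> real \<Rightarrow> 'z) \<Rightarrow> 'z set \<Rightarrow> 'z \<Rightarrow> ereal"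
  where "hit_time \<rho> M z =
    (if \<exists>s>0. \<rho> z s \<in> M then ereal (LEAST s. s > 0 \<and> \<rho> z s \<in> M) else \<infinity>)"

text \<open>
  \<open>imp_point \<rho> M I z n\<close> and \<open>imp_time \<rho> M I z n\<close> are the post-impulse point \<open>z\<^sub>n\<^sup>+\<close> and the
  impulse time \<open>t\<^sub>n\<close>. If the process stops at stage \<open>n\<close>, i.e. \<open>z\<^sub>n\<^sup>+\<close> never meets \<open>M\<close> again,
  then all later impulse times are \<open>\<infinity>\<close> and the later points are dummies.
\<close>

primrec imp_point ::
    "('z \<Rightarrow> real \<Rightarrow> 'z) \<Rightarrow> 'z set \<Rightarrow> ('z \<Rightarrow> 'z) \<Rightarrow> 'z \<Rightarrow> nat \<Rightarrow> 'z"
  where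
    "imp_point \<rho> M I z 0 = z"
  | "imp_point \<rho> M I z (Suc n) =
      (let w = imp_point \<rho> M I z n in
       if hit_time \<rho> M w = \<infinity> then w else I (\<rho> w (real_of_ereal (hit_time \<rho> M w))))"

primrec imp_time ::
    "('z \<Rightarrow> real \<Rightarrow> 'z) \<Rightarrow> 'z set \<Rightarrow> ('z \<Rightarrow> 'z) \<Rightarrow> 'z \<Rightarrow> nat \<Rightarrow> ereal"
  where
    "imp_time \<rho> M I z 0 = 0"
  | "imp_time \<rho> M I z (Suc n) =
      imp_time \<rho> M I z n + hit_time \<rho> M (imp_point \<rho> M I z n)"

definition in_stage ::
    "('z \<Rightarrow> real \<Rightarrow> 'z) \<Rightarrow> 'z set \<Rightarrow> ('z \<Rightarrow> 'z) \<Rightarrow> 'z \<Rightarrow> real \<Rightarrow> nat \<Rightarrow> bool"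
  where "in_stage \<rho> M I z t n \<longleftrightarrow>
    imp_time \<rho> M I z n \<le> ereal t \<and> ereal t < imp_time \<rho> M I z (Suc n)"

definition imp_traj_defined ::
    "('z \<Rightarrow> real \<Rightarrow> 'z) \<Rightarrow> 'z set \<Rightarrow> ('z \<Rightarrow> 'z) \<Rightarrow> 'z \<Rightarrow> real \<Rightarrow> bool"
  where "imp_traj_defined \<rho> M I z t \<longleftrightarrow> (\<exists>n. in_stage \<rho> M I z t n)"

definition imp_traj ::
    "('z \<Rightarrow> real \<Rightarrow> 'z) \<Rightarrow> 'z set \<Rightarrow> ('z \<Rightarrow> 'z) \<Rightarrow> 'z \<Rightarrow> real \<Rightarrow> 'z"
  where "imp_traj \<rho> M I z t =
    (let n = (THE n. in_stage \<rho> M I z t n)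
     in \<rho> (imp_point \<rho> M I z n) (t - real_of_ereal (imp_time \<rho> M I z n)))"

locale impulsive_semidynamical_system = semidynamical_system \<rho>
  for \<rho> :: "'z::metric_space \<Rightarrow> real \<Rightarrow> 'z" +
  fixes M :: "'z set" and I :: "'z \<Rightarrow> 'z"
  assumes M_nonempty: "M \<noteq> {}"
    and M_closed: "closed M"
    and M_isolating: "z \<in> M \<Longrightarrow>
      \<exists>\<epsilon>>0. past_set \<rho> {z} {0<..<\<epsilon>} \<inter> M = {} \<and> \<rho> z ` {0<..<\<epsilon>} \<inter> M = {}"
    and I_cont: "continuous_on M I"

locale standing_ISS = impulsive_semidynamical_system \<rho> M I
  for \<rho> :: "'z::metric_space \<Rightarrow> real \<Rightarrow> 'z" and M :: "'z set" and I :: "'z \<Rightarrow> 'z" +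
  assumes no_initial: "z \<in> M \<Longrightarrow> \<not> initial_point \<rho> z"
    and STC: "z \<in> M \<Longrightarrow> satisfies_STC \<rho> M z"
    and M_disjoint_image: "M \<inter> I ` M = {}"
    and global: "t \<ge> 0 \<Longrightarrow> imp_traj_defined \<rho> M I z t"

definition imp_orbit ::
    "('z \<Rightarrow> real \<Rightarrow> 'z) \<Rightarrow> 'z set \<Rightarrow> ('z \<Rightarrow> 'z) \<Rightarrow> 'z \<Rightarrow> 'z set"
  where "imp_orbit \<rho> M I z = {imp_traj \<rho> M I z t | t. t \<ge> 0}"

definition conv_seqs_to ::
    "('z::metric_space \<Rightarrow> real \<Rightarrow> 'z) \<Rightarrow> 'z set \<Rightarrow> ('z \<Rightarrow> 'z) \<Rightarrow> 'z \<Rightarrow> 'z \<Rightarrow> (nat \<Rightarrow> real) set"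
  where "conv_seqs_to \<rho> M I z p =
    {t. (\<forall>n. t n \<ge> 0) \<and> filterlim t at_top sequentially
        \<and> (\<lambda>n. imp_traj \<rho> M I z (t n)) \<longlonglongrightarrow> p}"

definition conv_seqs ::
    "('z::metric_space \<Rightarrow> real \<Rightarrow> 'z) \<Rightarrow> 'z set \<Rightarrow> ('z \<Rightarrow> 'z) \<Rightarrow> 'z \<Rightarrow> (nat \<Rightarrow> real) set"
  where "conv_seqs \<rho> M I z = (\<Union>p. conv_seqs_to \<rho> M I z p)"

definition limit_set ::
    "('z::metric_space \<Rightarrow> real \<Rightarrow> 'z) \<Rightarrow> 'z set \<Rightarrow> ('z \<Rightarrow> 'z) \<Rightarrow> 'z \<Rightarrow> 'z set"
  where "limit_set \<rho> M I z =
    {q. \<exists>t::nat \<Rightarrow> real. (\<forall>n. t n \<ge> 0) \<and> filterlim t at_top sequentially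
        \<and> (\<lambda>n. imp_traj \<rho> M I z (t n)) \<longlonglongrightarrow> q}"

definition almost_periodic ::
    "('z::metric_space \<Rightarrow> real \<Rightarrow> 'z) \<Rightarrow> 'z set \<Rightarrow> ('z \<Rightarrow> 'z) \<Rightarrow> 'z \<Rightarrow> bool"
  where "almost_periodic \<rho> M I p \<longleftrightarrow>
    (\<forall>\<epsilon>>0. \<exists>T>0. \<forall>\<alpha>\<ge>0. \<exists>\<tau>\<in>{\<alpha>..\<alpha> + T}. \<tau> > 0 \<and>
       (\<forall>t\<ge>0. dist (imp_traj \<rho> M I p (t + \<tau>)) (imp_traj \<rho> M I p t) < \<epsilon>))"

definition time_reparam :: "(real \<Rightarrow> real) \<Rightarrow> bool"
  where "time_reparam g \<longleftrightarrow> (\<exists>g'. homeomorphism {0..} {0..} g g') \<and> g 0 = 0"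

definition asymptotic_via ::
    "('z::metric_space \<Rightarrow> real \<Rightarrow> 'z) \<Rightarrow> 'z set \<Rightarrow> ('z \<Rightarrow> 'z) \<Rightarrow> 'z \<Rightarrow> 'z \<Rightarrow> (real \<Rightarrow> real) \<Rightarrow> bool"
  where "asymptotic_via \<rho> M I x z g \<longleftrightarrow>
    time_reparam g \<and>
    ((\<lambda>t. dist (imp_traj \<rho> M I x t) (imp_traj \<rho> M I z (g t))) \<longlongrightarrow> 0) at_top"

definition asymp_almost_periodic ::
    "('z::metric_space \<Rightarrow> real \<Rightarrow> 'z) \<Rightarrow> 'z set \<Rightarrow> ('z \<Rightarrow> 'z) \<Rightarrow> 'z \<Rightarrow> bool"
  where "asymp_almost_periodic \<rho> M I x \<longleftrightarrow>
    (\<exists>p g. almost_periodic \<rho> M I p \<and> asymptotic_via \<rho> M I x p g)"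

text \<open>The set \<open>\<P>\<^sub>x\<close>.\<close>

definition asymp_recurrent_set ::
    "('z::metric_space \<Rightarrow> real \<Rightarrow> 'z) \<Rightarrow> 'z set \<Rightarrow> ('z \<Rightarrow> 'z) \<Rightarrow> 'z \<Rightarrow> 'z set"
  where "asymp_recurrent_set \<rho> M I x =
    {z \<in> limit_set \<rho> M I x \<inter> limit_set \<rho> M I z. \<exists>g. asymptotic_via \<rho> M I x z g}"

definition comparable_in_limit ::
    "('y::metric_space \<Rightarrow> real \<Rightarrow> 'y) \<Rightarrow> 'y set \<Rightarrow> ('y \<Rightarrow> 'y) \<Rightarrow> 'y \<Rightarrow>
     ('x::metric_space \<Rightarrow> real \<Rightarrow> 'x) \<Rightarrow> 'x set \<Rightarrow> ('x \<Rightarrow> 'x) \<Rightarrow> 'x \<Rightarrow> bool"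
  where "comparable_in_limit \<sigma> MY IY y \<pi> MX IX x \<longleftrightarrow>
    conv_seqs \<pi> MX IX x \<subseteq> conv_seqs \<sigma> MY IY y"

end

theory Submission
  imports Defs
begin

text \<open>
  The comparison map \<open>h\<close> sends \<open>lim f (t\<^sub>n)\<close> to \<open>lim k (t\<^sub>n)\<close>, where \<open>f\<close> and \<open>k\<close> are the
  trajectories of \<open>x\<close> and \<open>y\<close>: interleaving two time sequences shows that it is well defined,
  a diagonal choice of times that it is continuous. Conjugacy follows by passing to the limit
  in \<open>f (t\<^sub>n + s)\<close> and \<open>k (t\<^sub>n + s)\<close> for small \<open>s > 0\<close> beyond a given time, which avoids
  impulse times, and then letting \<open>s\<close> tend to \<open>0\<close>. This uses that the tubes make
  the hitting time of \<open>M\<close> continuous off \<open>M\<close>; the case \<open>h q \<in> M\<^sub>Y\<close> needs in addition that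
  \<open>k (t\<^sub>n)\<close> approaches \<open>h q\<close> from the side that has already passed \<open>M\<^sub>Y\<close>. The asymptotic
  statement then follows from compactness by extracting subsequences.
\<close>

section \<open>Limits of a trajectory along time sequences\<close>

definition convergence_times :: "(real \<Rightarrow> 'a::metric_space) \<Rightarrow> 'a \<Rightarrow> (nat \<Rightarrow> real) set"
  where "convergence_times f q =
    {t. (\<forall>n. t n \<ge> 0) \<and> filterlim t at_top sequentially \<and> (\<lambda>n. f (t n)) \<longlonglongrightarrow> q}"

lemma convergence_times_interleave:
  assumes "s \<in> convergence_times f q" "t \<in> convergence_times f q"
  shows "(\<lambda>n. if even n then s (n div 2) else t (n div 2)) \<in> convergence_times f q"
proof -
  \<comment> \<open>An arbitrary target filter \<open>F\<close> lets one fact serve both the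
    divergence of the merged times and the convergence of the values along them.\<close>
  have *: "filterlim (\<lambda>n. if even n then a (n div 2) else b (n div 2)) F sequentially"
    if "filterlim a F sequentially" "filterlim b F sequentially" for a b :: "nat \<Rightarrow> 'c" and F
  proof -
    have half: "filterlim (\<lambda>n::nat. n div 2) sequentially sequentially"
      by (rule filterlim_at_top_div_const_nat) simp
    show ?thesis
      unfolding filterlim_iff
    proof (intro allI impI)
      fix P
      assume "eventually P F"
      then have "\<forall>\<^sub>F n in sequentially. P (a (n div 2))" "\<forall>\<^sub>F n in sequentially. P (b (n div 2))"
        using filterlim_compose[OF that(1) half] filterlim_compose[OF that(2) half]
        unfolding filterlim_iff by blast+
      then show "\<forall>\<^sub>F n in sequentially. P (if even n then a (n div 2) else b (n div 2))"
        by eventually_elim simp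
    qed
  qed
  have "(\<lambda>n. if even n then f (s (n div 2)) else f (t (n div 2))) \<longlonglongrightarrow> q"
    by (rule *) (use assms in \<open>auto simp: convergence_times_def\<close>)
  then have "(\<lambda>n. f (if even n then s (n div 2) else t (n div 2))) \<longlonglongrightarrow> q"
    by (simp add: if_distrib[of f])
  with assms show ?thesis
    by (auto simp: convergence_times_def intro!: *)
qed

lemma convergence_times_unique:
  assumes "t \<in> convergence_times f p" "t \<in> convergence_times f q"
  shows "p = q"
  using assms LIMSEQ_unique by (auto simp: convergence_times_def)

lemma convergence_times_subseq:
  assumes "t \<in> convergence_times f q" "strict_mono r"
  shows "t \<circ> r \<in> convergence_times f q"
proof -
  have r: "filterlim r sequentially sequentially"
    using assms(2) by (rule filterlim_subseq)
  have "filterlim (\<lambda>n. t (r n)) at_top sequentially" "(\<lambda>n. f (t (r n))) \<longlonglongrightarrow> q"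
    using filterlim_compose[OF _ r, of t] filterlim_compose[OF _ r, of "\<lambda>n. f (t n)"] assms(1)
    by (simp_all add: convergence_times_def)
  with assms(1) show ?thesis
    by (simp add: convergence_times_def o_def)
qed

text \<open>Fix one reference sequence \<open>s\<close> for \<open>q\<close> and merge it with any
  other \<open>t\<close>. The merged sequence has some limit under \<open>k\<close>, inherited by
  \<open>s\<close> and by \<open>t\<close>. Since the limit along \<open>s\<close> is unique, it
  cannot depend on \<open>t\<close>. If \<open>q\<close> has no convergence times, any value serves,
  so \<open>h\<close> can be total.\<close>

lemma comparison_map_exists:
  assumes "(\<Union>q. convergence_times f q) \<subseteq> (\<Union>p. convergence_times k p)"
  shows "\<exists>h. \<forall>q. convergence_times f q \<subseteq> convergence_times k (h q)"
proof -
  have "\<exists>p. convergence_times f q \<subseteq> convergence_times k p" for q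
  proof (cases "convergence_times f q = {}")
    case False
    then obtain s where s: "s \<in> convergence_times f q" by blast
    have "\<exists>p. s \<in> convergence_times k p \<and> t \<in> convergence_times k p"
      if t: "t \<in> convergence_times f q" for t
    proof -
      define u where "u = (\<lambda>n. if even n then s (n div 2) else t (n div 2))"
      have "u \<in> convergence_times f q"
        unfolding u_def using s t by (rule convergence_times_interleave)
      then obtain p where p: "u \<in> convergence_times k p"
        using assms by blast
      \<comment> \<open>The even and the odd positions of \<open>u\<close> give back the two
        original sequences.\<close>
      have "u \<circ> (\<lambda>n. 2 * n) = s" "u \<circ> (\<lambda>n. 2 * n + 1) = t"
        by (auto simp: u_def fun_eq_iff)
      then show ?thesis
        using convergence_times_subseq[OF p, of "\<lambda>n. 2 * n"]
          convergence_times_subseq[OF p, of "\<lambda>n. 2 * n + 1"]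
        by (auto simp: strict_mono_def)
    qed
    then show ?thesis
      using s convergence_times_unique by (metis subsetI)
  qed auto
  then show ?thesis by metis
qed

lemma tendsto_dist_zero_transform:
  assumes "(a \<longlongrightarrow> l) F" and "((\<lambda>x. dist (a x) (b x)) \<longlongrightarrow> 0) F"
  shows "(b \<longlongrightarrow> l) F"
proof -
  have "((\<lambda>x. dist (a x) (b x) + dist (a x) l) \<longlongrightarrow> 0 + 0) F"
    using assms by (intro tendsto_add) (simp_all flip: tendsto_dist_iff)
  then have "((\<lambda>x. dist (b x) l) \<longlongrightarrow> 0) F"
    by (intro Lim_null_comparison[of "\<lambda>x. dist (b x) l"])
      (auto intro!: always_eventually dist_triangle3)
  then show ?thesis
    by (simp flip: tendsto_dist_iff)
qed

lemma tendsto_dist_less_inverse_transform: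
  assumes "a \<longlonglongrightarrow> l" and "\<And>n. dist (a n) (b n) < 1 / (real n + 1)"
  shows "b \<longlonglongrightarrow> l"
proof -
  have "(\<lambda>n. 1 / (real n + 1)) \<longlonglongrightarrow> 0"
    using LIMSEQ_inverse_real_of_nat by (simp add: inverse_eq_divide add.commute)
  then have "(\<lambda>n. dist (a n) (b n)) \<longlonglongrightarrow> 0"
    by (rule Lim_null_comparison[rotated]) (use assms(2) in \<open>auto simp: less_imp_le\<close>)
  with assms(1) show ?thesis
    by (rule tendsto_dist_zero_transform)
qed

section \<open>Continuity of the comparison map and transfer of asymptotics\<close>

locale limit_comparison =
  fixes f :: "real \<Rightarrow> 'a::metric_space" and k :: "real \<Rightarrow> 'b::metric_space" and h :: "'a \<Rightarrow> 'b"
  assumes times_subset: "convergence_times f q \<subseteq> convergence_times k (h q)"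
begin

text \<open>For each \<open>n\<close>, one late time \<open>t n\<close> is chosen at which
  \<open>f\<close> is close to \<open>q n\<close> and, simultaneously, \<open>k\<close> is close to
  \<open>h (q n)\<close>. Then \<open>t\<close> is a convergence sequence for \<open>l\<close>, so
  \<open>k\<close> tends to \<open>h l\<close> along it, and \<open>h (q n)\<close> is dragged
  along. The same choice thus gives closedness of the set of limit points and sequential continuity
  of \<open>h\<close> on it.\<close>

lemma diagonal_times:
  assumes "\<And>n. convergence_times f (q n) \<noteq> {}" "q \<longlonglongrightarrow> l"
  shows "convergence_times f l \<noteq> {}" and "(\<lambda>n. h (q n)) \<longlonglongrightarrow> h l"
proof -
  have "\<exists>t\<ge>real n. dist (q n) (f t) < 1 / (real n + 1) \<and> dist (k t) (h (q n)) < 1 / (real n + 1)"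
    for n
  proof -
    obtain s where s: "s \<in> convergence_times f (q n)" using assms(1) by blast
    then have "s \<in> convergence_times k (h (q n))" using times_subset by blast
    then have "\<forall>\<^sub>F i in sequentially. dist (k (s i)) (h (q n)) < 1 / (real n + 1)"
      by (intro tendstoD) (auto simp: convergence_times_def)
    moreover have "\<forall>\<^sub>F i in sequentially. dist (f (s i)) (q n) < 1 / (real n + 1)"
      using s by (intro tendstoD) (auto simp: convergence_times_def)
    moreover have "\<forall>\<^sub>F i in sequentially. s i \<ge> real n"
      using s by (auto simp: convergence_times_def filterlim_at_top)
    ultimately have "\<forall>\<^sub>F i in sequentially. s i \<ge> real n \<and> dist (f (s i)) (q n) < 1 / (real n + 1)
        \<and> dist (k (s i)) (h (q n)) < 1 / (real n + 1)"
      by eventually_elim auto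
    then obtain i where "s i \<ge> real n" "dist (f (s i)) (q n) < 1 / (real n + 1)"
        "dist (k (s i)) (h (q n)) < 1 / (real n + 1)"
      using eventually_happens'[OF sequentially_bot] by force
    then show ?thesis
      by (auto simp: dist_commute)
  qed
  then obtain t where t: "\<And>n. t n \<ge> real n" "\<And>n. dist (q n) (f (t n)) < 1 / (real n + 1)"
    "\<And>n. dist (k (t n)) (h (q n)) < 1 / (real n + 1)"
    by metis
  have "filterlim t at_top sequentially"
    by (rule filterlim_at_top_mono[OF filterlim_real_sequentially]) (simp add: t(1))
  moreover have "(\<lambda>n. f (t n)) \<longlonglongrightarrow> l"
    using assms(2) t(2) by (rule tendsto_dist_less_inverse_transform)
  moreover have "t n \<ge> 0" for n
    using t(1)[of n] by linarith
  ultimately have t_in: "t \<in> convergence_times f l"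
    by (auto simp: convergence_times_def)
  then show "convergence_times f l \<noteq> {}" by blast
  have "t \<in> convergence_times k (h l)" using t_in times_subset by blast
  then have "(\<lambda>n. k (t n)) \<longlonglongrightarrow> h l" by (simp add: convergence_times_def)
  then show "(\<lambda>n. h (q n)) \<longlonglongrightarrow> h l"
    using t(3) by (rule tendsto_dist_less_inverse_transform)
qed

lemma closed_limit_points: "closed {q. convergence_times f q \<noteq> {}}"
  unfolding closed_sequential_limits using diagonal_times(1) by blast

lemma continuous_on_limit_points: "continuous_on {q. convergence_times f q \<noteq> {}} h"
  unfolding continuous_on_sequentially o_def using diagonal_times(2) by auto

text \<open>Along bad times tending to infinity, compactness gives a subsequence on which
  \<open>f\<close> tends to some \<open>l\<close>, and \<open>r\<close> must tend to
  \<open>l\<close> as well. Now \<open>k\<close> tends to \<open>h l\<close> because the times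
  converge for \<open>l\<close>, and \<open>h (r t)\<close> tends to \<open>h l\<close> by
  continuity of \<open>h\<close>, a contradiction. In the application \<open>r\<close> is the
  reparametrized trajectory of a point of the limit set.\<close>

lemma asymptotic_comparison:
  assumes "compact K" "\<And>t. t \<ge> 0 \<Longrightarrow> f t \<in> K"
    and r: "\<And>t. t \<ge> 0 \<Longrightarrow> convergence_times f (r t) \<noteq> {}"
    and lim: "((\<lambda>t. dist (f t) (r t)) \<longlongrightarrow> 0) at_top"
  shows "((\<lambda>t. dist (k t) (h (r t))) \<longlongrightarrow> 0) at_top"
proof (rule tendstoI, rule ccontr)
  fix e :: real
  assume "e > 0" and *: "\<not> (\<forall>\<^sub>F t in at_top. dist (dist (k t) (h (r t))) 0 < e)"
  have "\<exists>t\<ge>real n. dist (k t) (h (r t)) \<ge> e" for n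
    using * unfolding eventually_at_top_linorder dist_real_def by (metis abs_of_nonneg diff_zero not_less zero_le_dist)
  then obtain t where t: "\<And>n. t n \<ge> real n" "\<And>n. dist (k (t n)) (h (r (t n))) \<ge> e" by metis
  have t0: "t n \<ge> 0" for n using t(1)[of n] by linarith
  obtain l s where l: "strict_mono s" "((\<lambda>n. f (t n)) \<circ> s) \<longlonglongrightarrow> l"
    using assms(1,2) t0 unfolding compact_def by (metis (no_types, lifting))
  have "filterlim t at_top sequentially"
    by (rule filterlim_at_top_mono[OF filterlim_real_sequentially]) (simp add: t(1))
  then have ts: "filterlim (t \<circ> s) at_top sequentially"
    unfolding o_def by (rule filterlim_compose[OF _ filterlim_subseq[OF l(1)]])
  with l t0 have "t \<circ> s \<in> convergence_times f l"
    by (auto simp: convergence_times_def o_def)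
  then have "(\<lambda>n. k (t (s n))) \<longlonglongrightarrow> h l"
    using times_subset by (fastforce simp: convergence_times_def)
  moreover have "(\<lambda>n. dist (f (t (s n))) (r (t (s n)))) \<longlonglongrightarrow> 0"
    using filterlim_compose[OF lim ts] by (simp add: o_def)
  then have "(\<lambda>n. r (t (s n))) \<longlonglongrightarrow> l"
    by (rule tendsto_dist_zero_transform[rotated]) (use l(2) in \<open>simp add: o_def\<close>)
  then have "(\<lambda>n. h (r (t (s n)))) \<longlonglongrightarrow> h l"
    by (intro diagonal_times(2)) (use r t0 in auto)
  ultimately have "(\<lambda>n. dist (k (t (s n))) (h (r (t (s n))))) \<longlonglongrightarrow> dist (h l) (h l)"
    by (rule tendsto_dist)
  then have "\<forall>\<^sub>F n in sequentially. dist (k (t (s n))) (h (r (t (s n)))) < e"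
    using \<open>e > 0\<close> by (auto dest: order_tendstoD(2))
  then show False
    using t(2) eventually_happens'[OF sequentially_bot] by (meson not_less)
qed

end

section \<open>Continuity properties of the flow\<close>

context semidynamical_system
begin

lemma tendsto_flow:
  assumes "(u \<longlongrightarrow> z) F" "(t \<longlongrightarrow> s) F" "\<forall>\<^sub>F i in F. 0 \<le> t i" "0 \<le> s"
  shows "((\<lambda>i. \<rho> (u i) (t i)) \<longlongrightarrow> \<rho> z s) F"
proof -
  have "((\<lambda>i. (\<lambda>(z, t). \<rho> z t) (u i, t i)) \<longlongrightarrow> (\<lambda>(z, t). \<rho> z t) (z, s)) F"
    by (rule continuous_on_tendsto_compose[OF cont])
      (use assms in \<open>auto intro!: tendsto_Pair\<close>)
  then show ?thesis by simp
qed

lemma continuous_on_flow: "continuous_on {0..} (\<rho> z)"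
proof -
  have "continuous_on {0..} (\<lambda>t. (\<lambda>(z, t). \<rho> z t) (z, t))"
    by (rule continuous_on_compose2[OF cont]) (auto intro!: continuous_intros)
  then show ?thesis by simp
qed

text \<open>The set of pairs \<open>(u, t)\<close> with \<open>\<rho> u t\<close> outside
  \<open>C\<close> is relatively open and contains \<open>{z} \<times> K\<close>; compactness of
  \<open>K\<close> thickens this to a product neighbourhood. With \<open>C = M\<close> it bounds
  hitting times from below, with \<open>C = L\<close> it localizes the time at which a tube point
  reaches \<open>L\<close>.\<close>

lemma eventually_flow_avoids:
  assumes "compact K" "K \<subseteq> {0..}" "closed C" "\<And>t. t \<in> K \<Longrightarrow> \<rho> z t \<notin> C"
  shows "\<forall>\<^sub>F u in nhds z. \<forall>t\<in>K. \<rho> u t \<notin> C"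
proof -
  obtain W where W: "open W" "W \<inter> (UNIV \<times> {0..}) = (\<lambda>(z, t). \<rho> z t) -` (- C) \<inter> (UNIV \<times> {0..})"
    using cont \<open>closed C\<close> unfolding continuous_on_open_invariant by (metis open_Compl)
  have W_iff: "(u, t) \<in> W \<longleftrightarrow> \<rho> u t \<notin> C" if "t \<in> K" for u t
    using W(2) that \<open>K \<subseteq> {0..}\<close> by (auto simp: set_eq_iff)
  then have "{z} \<times> K \<subseteq> W"
    using assms(4) by auto
  then obtain U where "z \<in> U" "open U" "U \<times> K \<subseteq> W"
    using Elementary_Topology.tube_lemma[OF \<open>compact K\<close> \<open>open W\<close>] by blast
  then show ?thesis
    unfolding eventually_nhds using W_iff by blast
qed

end

section \<open>Hitting times and stages of impulsive trajectories\<close>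

context impulsive_semidynamical_system
begin

abbreviation "hit \<equiv> hit_time \<rho> M"
abbreviation "imp \<equiv> imp_traj \<rho> M I"

text \<open>On \<open>M\<close> this is the isolating assumption, off \<open>M\<close> it follows
  from closedness of \<open>M\<close>.\<close>

lemma not_hit_immediately: "\<exists>\<epsilon>>0. \<forall>r. 0 < r \<and> r < \<epsilon> \<longrightarrow> \<rho> z r \<notin> M"
proof (cases "z \<in> M")
  case True
  then show ?thesis
    using M_isolating[OF True] by (auto simp: image_subset_iff disjoint_iff)
next
  case False
  have "((\<lambda>r. \<rho> z r) \<longlongrightarrow> \<rho> z 0) (at_right 0)"
    by (rule tendsto_flow) (auto intro: eventually_at_right_less eventually_mono)
  then have "\<forall>\<^sub>F r in at_right 0. \<rho> z r \<in> - M"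
    using False M_closed by (intro topological_tendstoD) (auto simp: zero)
  then show ?thesis
    by (auto simp: eventually_at_right_field)
qed

lemma hit_time_cases:
  obtains (never) "hit z = \<infinity>" "\<And>s. s > 0 \<Longrightarrow> \<rho> z s \<notin> M"
  | (hits) s where "hit z = ereal s" "s > 0" "\<rho> z s \<in> M" "\<And>r. 0 < r \<Longrightarrow> r < s \<Longrightarrow> \<rho> z r \<notin> M"
proof (cases "\<exists>s>0. \<rho> z s \<in> M")
  case True
  define A where "A = {s. s > 0 \<and> \<rho> z s \<in> M}"
  obtain \<epsilon> where \<epsilon>: "\<epsilon> > 0" "\<And>r. 0 < r \<Longrightarrow> r < \<epsilon> \<Longrightarrow> \<rho> z r \<notin> M"
    using not_hit_immediately by blast
  \<comment> \<open>Positivity alone is not a closed condition; since no hit occurs before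
    \<open>\<epsilon>\<close>, it can be replaced by \<open>\<epsilon> \<le> s\<close>. So
    \<open>A\<close> is closed and its infimum is attained.\<close>
  have "A = {\<epsilon>..} \<inter> \<rho> z -` M"
    using \<epsilon> by (force simp: A_def not_less[symmetric])
  moreover have "closed ({\<epsilon>..} \<inter> \<rho> z -` M)"
    using \<epsilon>(1) M_closed
    by (intro continuous_closed_preimage continuous_on_subset[OF continuous_on_flow]) auto
  ultimately have "closed A" by simp
  have bdd: "bdd_below A"
    by (rule bdd_belowI[of _ 0]) (simp add: A_def)
  have "Inf A \<in> A"
    using True \<open>closed A\<close> bdd by (intro closed_contains_Inf) (auto simp: A_def)
  moreover have "Inf A \<le> s" if "s \<in> A" for s
    using bdd that by (rule cInf_lower[rotated])
  ultimately have "(LEAST s. s > 0 \<and> \<rho> z s \<in> M) = Inf A"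
    by (intro Least_equality) (auto simp: A_def)
  then have "hit z = ereal (Inf A)"
    using True by (simp add: hit_time_def)
  moreover have "\<rho> z r \<notin> M" if "0 < r" "r < Inf A" for r
    using \<open>\<And>s. s \<in> A \<Longrightarrow> Inf A \<le> s\<close>[of r] that by (auto simp: A_def)
  ultimately show thesis
    using \<open>Inf A \<in> A\<close> hits by (auto simp: A_def)
next
  case False
  then show thesis
    using never by (auto simp: hit_time_def)
qed

lemma hit_time_pos: "0 < hit z"
  by (cases rule: hit_time_cases[of z]) auto

lemma less_hit_time_iff:
  assumes "0 \<le> c"
  shows "ereal c < hit z \<longleftrightarrow> (\<forall>r. 0 < r \<and> r \<le> c \<longrightarrow> \<rho> z r \<notin> M)"
  by (cases rule: hit_time_cases[of z]) (use assms in \<open>auto simp: not_less[symmetric]\<close>)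

lemma hit_time_le: "0 < r \<Longrightarrow> \<rho> z r \<in> M \<Longrightarrow> hit z \<le> ereal r"
  using less_hit_time_iff[of r z] by (auto simp: not_less[symmetric])

lemma hit_time_finite:
  assumes "hit z = ereal s"
  shows "s > 0" "\<rho> z s \<in> M"
  using assms by (cases rule: hit_time_cases[of z]; simp)+

lemma hit_time_flow:
  assumes "0 \<le> t" "ereal t < hit z"
  shows "hit z = hit (\<rho> z t) + ereal t"
proof (cases rule: hit_time_cases[of "\<rho> z t"])
  case never
  have "\<rho> z s \<notin> M" if "s > 0" for s
  proof (cases "s \<le> t")
    case True
    then show ?thesis using assms that less_hit_time_iff by blast
  next
    case False
    then show ?thesis using never(2)[of "s - t"] add[of t "s - t" z] assms by simp
  qed
  then show ?thesis
    using never(1) by (simp add: hit_time_def)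
next
  case (hits s)
  have "\<rho> z r \<notin> M" if "0 < r" "r < t + s" for r
  proof (cases "r \<le> t")
    case True
    then show ?thesis using assms that less_hit_time_iff by blast
  next
    case False
    then show ?thesis using hits(4)[of "r - t"] add[of t "r - t" z] assms that by simp
  qed
  moreover have "\<rho> z (t + s) \<in> M"
    using hits assms add by simp
  ultimately have "hit z = ereal (t + s)"
    using hits(2) assms
    by (cases rule: hit_time_cases[of z]) (metis add_nonneg_pos linorder_neqE_linordered_idom)+
  with hits show ?thesis by (simp add: add.commute)
qed

lemma imp_time_mono: "m \<le> n \<Longrightarrow> imp_time \<rho> M I z m \<le> imp_time \<rho> M I z n"
  by (rule lift_Suc_mono_le) (simp_all add: less_imp_le[OF hit_time_pos] ereal_le_add_self)

lemma in_stage_unique: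
  assumes "in_stage \<rho> M I z t n" "in_stage \<rho> M I z t m"
  shows "n = m"
proof (rule ccontr)
  have "False" if "in_stage \<rho> M I z t i" "in_stage \<rho> M I z t j" "i < j" for i j
    using imp_time_mono[of "Suc i" j z] that unfolding in_stage_def by auto
  moreover assume "n \<noteq> m"
  ultimately show False
    using assms by (metis linorder_neqE_nat)
qed

lemma imp_traj_in_stage:
  assumes "in_stage \<rho> M I z t n"
  shows "imp z t = \<rho> (imp_point \<rho> M I z n) (t - real_of_ereal (imp_time \<rho> M I z n))"
proof -
  have "(THE n. in_stage \<rho> M I z t n) = n"
    using assms in_stage_unique by blast
  then show ?thesis by (simp add: imp_traj_def)
qed

lemma in_stage_0_iff: "in_stage \<rho> M I z t 0 \<longleftrightarrow> 0 \<le> t \<and> ereal t < hit z"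
  by (simp add: in_stage_def)

lemma imp_traj_before_impulse: "0 \<le> t \<Longrightarrow> ereal t < hit z \<Longrightarrow> imp z t = \<rho> z t"
  using imp_traj_in_stage[of z t 0] by (simp add: in_stage_0_iff)

text \<open>The recursion adds impulses at the end, whereas the later inductions on stages remove
  the first impulse and restart at \<open>I (\<rho> z s)\<close>. This lemma and its analogue for
  \<open>imp_time\<close> translate between the two views.\<close>

lemma imp_point_Suc_shift:
  assumes "hit z = ereal s"
  shows "imp_point \<rho> M I z (Suc n) = imp_point \<rho> M I (I (\<rho> z s)) n"
proof (induction n)
  case (Suc n)
  then show ?case by (subst (1 2) imp_point.simps) simp
qed (simp add: assms)

lemma imp_time_Suc_shift:
  assumes "hit z = ereal s"
  shows "imp_time \<rho> M I z (Suc n) = ereal s + imp_time \<rho> M I (I (\<rho> z s)) n"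
proof (induction n)
  case (Suc n)
  then show ?case
    by (subst (1 2) imp_time.simps, subst imp_point_Suc_shift[OF assms]) (simp add: add.assoc)
qed (simp add: assms)

lemma in_stage_Suc_iff:
  assumes "hit z = ereal s"
  shows "in_stage \<rho> M I z t (Suc n) \<longleftrightarrow> in_stage \<rho> M I (I (\<rho> z s)) (t - s) n"
proof -
  have "ereal s + a \<le> ereal t \<longleftrightarrow> a \<le> ereal (t - s)" "ereal t < ereal s + a \<longleftrightarrow> ereal (t - s) < a" for a
    by (cases a; auto)+
  then show ?thesis
    unfolding in_stage_def imp_time_Suc_shift[OF assms] by simp
qed

lemma hit_time_finite_if_in_stage_Suc:
  assumes "in_stage \<rho> M I z t (Suc n)"
  obtains s where "hit z = ereal s" "s \<le> t"
proof -
  have "imp_time \<rho> M I z (Suc 0) \<le> imp_time \<rho> M I z (Suc n)"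
    by (rule imp_time_mono) simp
  then have "hit z \<le> ereal t"
    using assms by (auto simp: in_stage_def)
  then show thesis
    using that by (cases rule: hit_time_cases[of z]) auto
qed

end

section \<open>Semigroup property and right continuity of impulsive trajectories\<close>

context standing_ISS
begin

lemma in_stageE:
  assumes "0 \<le> t"
  obtains n where "in_stage \<rho> M I z t n"
  using global[OF assms, of z] by (auto simp: imp_traj_defined_def)

lemma imp_traj_after_impulse:
  assumes "hit z = ereal s" "s \<le> t"
  shows "imp z t = imp (I (\<rho> z s)) (t - s)"
proof -
  obtain n where n: "in_stage \<rho> M I (I (\<rho> z s)) (t - s) n"
    using assms in_stageE[of "t - s"] by auto
  then have "0 \<le> imp_time \<rho> M I (I (\<rho> z s)) n" "imp_time \<rho> M I (I (\<rho> z s)) n \<le> ereal (t - s)"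
    using imp_time_mono[of 0 n] by (auto simp: in_stage_def)
  \<comment> \<open>Finiteness of the stage time lets \<open>real_of_ereal\<close> be evaluated on
    the shifted sum.\<close>
  then obtain r where r: "imp_time \<rho> M I (I (\<rho> z s)) n = ereal r"
    by (cases "imp_time \<rho> M I (I (\<rho> z s)) n") auto
  have "in_stage \<rho> M I z t (Suc n)"
    using n in_stage_Suc_iff[OF assms(1)] by simp
  from imp_traj_in_stage[OF this] imp_traj_in_stage[OF n] show ?thesis
    by (simp only: imp_point_Suc_shift[OF assms(1)] imp_time_Suc_shift[OF assms(1)] r)
      (simp add: algebra_simps)
qed

text \<open>Induction on the stage of \<open>t\<close> with \<open>z\<close> arbitrary. In stage 0
  the point at time \<open>t\<close> lies on the first flow segment, and the cases are whether the
  further time \<open>r\<close> stays before the next impulse or reaches it. Otherwise the first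
  impulse is removed from both sides.\<close>

lemma imp_traj_add:
  assumes "0 \<le> t" "0 \<le> r"
  shows "imp (imp z t) r = imp z (t + r)"
proof -
  obtain n where "in_stage \<rho> M I z t n" using in_stageE \<open>0 \<le> t\<close> by blast
  then show ?thesis
    using \<open>0 \<le> t\<close>
  proof (induction n arbitrary: z t)
    case 0
    define w where "w = \<rho> z t"
    have t: "ereal t < hit z" using 0 by (simp add: in_stage_0_iff)
    have hit: "hit z = hit w + ereal t"
      using hit_time_flow[OF \<open>0 \<le> t\<close> t] by (simp add: w_def)
    have w: "imp z t = w"
      using imp_traj_before_impulse[OF \<open>0 \<le> t\<close> t] by (simp add: w_def)
    show ?case
    proof (cases "ereal r < hit w")
      case True
      then have "ereal (t + r) < hit z"
        unfolding hit by (cases "hit w") auto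
      then show ?thesis
        using True imp_traj_before_impulse[of r w] imp_traj_before_impulse[of "t + r" z] 0 \<open>0 \<le> r\<close>
        by (simp add: w w_def add)
    next
      case False
      then obtain s where s: "hit w = ereal s" "s \<le> r"
        using hit_time_pos[of w] by (cases "hit w") auto
      then have "imp z (t + r) = imp (I (\<rho> z (s + t))) (t + r - (s + t))"
        using hit by (intro imp_traj_after_impulse) auto
      moreover have "\<rho> z (s + t) = \<rho> w s"
        using hit_time_finite[OF s(1)] 0 by (simp add: w_def add add.commute)
      ultimately show ?thesis
        using imp_traj_after_impulse[OF s] by (simp add: w algebra_simps)
    qed
  next
    case (Suc n)
    obtain s where s: "hit z = ereal s" "s \<le> t"
      using hit_time_finite_if_in_stage_Suc Suc.prems(1) by blast
    then have "imp (imp (I (\<rho> z s)) (t - s)) r = imp (I (\<rho> z s)) (t - s + r)"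
      using Suc.prems in_stage_Suc_iff by (intro Suc.IH) auto
    then show ?case
      using imp_traj_after_impulse[OF s(1), of t] imp_traj_after_impulse[OF s(1), of "t + r"] s \<open>0 \<le> r\<close>
      by (simp add: algebra_simps)
  qed
qed

lemma imp_traj_0: "imp z 0 = z"
  using imp_traj_before_impulse[of 0 z] hit_time_pos[of z] by (simp add: zero zero_ereal_def)

text \<open>Inside a stage the definition of \<open>hit\<close> keeps the trajectory off
  \<open>M\<close>, and at an impulse time it sits in the image of \<open>I\<close>, which is
  disjoint from \<open>M\<close>. The only exception is an initial point already in
  \<open>M\<close>.\<close>

lemma imp_traj_notin_M:
  assumes "0 \<le> t" "t = 0 \<Longrightarrow> z \<notin> M"
  shows "imp z t \<notin> M"
proof -
  obtain n where "in_stage \<rho> M I z t n" using in_stageE \<open>0 \<le> t\<close> by blast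
  then show ?thesis
    using assms
  proof (induction n arbitrary: z t)
    case 0
    then show ?case
      using imp_traj_before_impulse[of t z] less_hit_time_iff[of t z] imp_traj_0[of z]
      by (cases "t = 0") (auto simp: in_stage_0_iff)
  next
    case (Suc n)
    obtain s where s: "hit z = ereal s" "s \<le> t"
      using hit_time_finite_if_in_stage_Suc Suc.prems(1) by blast
    have "imp (I (\<rho> z s)) (t - s) \<notin> M"
      using Suc.prems s in_stage_Suc_iff hit_time_finite[OF s(1)] M_disjoint_image
      by (intro Suc.IH) auto
    then show ?case
      using imp_traj_after_impulse[OF s] by simp
  qed
qed

text \<open>Since \<open>hit\<close> is positive everywhere, even on \<open>M\<close>, the
  trajectory coincides with the flow of \<open>imp z t\<close> for a short time after
  \<open>t\<close>.\<close>

lemma tendsto_at_right_imp_traj: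
  assumes "0 \<le> t"
  shows "((\<lambda>s. imp z (t + s)) \<longlongrightarrow> imp z t) (at_right 0)"
proof -
  have "((\<lambda>s. \<rho> (imp z t) s) \<longlongrightarrow> \<rho> (imp z t) 0) (at_right 0)"
    by (rule tendsto_flow) (auto intro: eventually_at_right_less eventually_mono)
  moreover obtain d where d: "d > 0" "ereal d < hit (imp z t)"
    using hit_time_pos[of "imp z t"] ereal_dense2[of 0 "hit (imp z t)"] by auto
  have "\<forall>\<^sub>F s in at_right 0. \<rho> (imp z t) s = imp z (t + s)"
    unfolding eventually_at_right_field
  proof (intro exI[of _ d] conjI allI impI)
    fix s assume "0 < s" "s < d"
    then have "ereal s < hit (imp z t)"
      using d(2) by (metis ereal_less(2) less_trans less_ereal.simps(1))
    then show "\<rho> (imp z t) s = imp z (t + s)"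
      using imp_traj_before_impulse[of s "imp z t"] imp_traj_add[OF assms, of s z] \<open>0 < s\<close> by simp
  qed (rule d)
  ultimately show ?thesis
    by (simp add: zero tendsto_cong)
qed

section \<open>Tubes and continuity of the hitting time\<close>

text \<open>In terms of \<^const>\<open>satisfies_STC\<close>, \<open>\<rho> u s \<in> L\<close> says \<open>u \<in> F(L, s)\<close>; the set \<open>S\<close> is eliminated.\<close>

definition tube_around :: "'z \<Rightarrow> real \<Rightarrow> 'z set \<Rightarrow> bool"
  where "tube_around b \<kappa> L \<longleftrightarrow> \<kappa> > 0 \<and> closed L \<and> \<rho> b \<kappa> \<in> L
    \<and> (\<forall>\<^sub>F u in nhds b. \<exists>s\<in>{0..2 * \<kappa>}. \<rho> u s \<in> L)
    \<and> (\<forall>u. \<forall>s\<in>{0..2 * \<kappa>}. \<forall>s'\<in>{0..2 * \<kappa>}. \<rho> u s \<in> L \<longrightarrow> \<rho> u s' \<in> L \<longrightarrow> s = s')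
    \<and> (\<forall>u. \<forall>s\<in>{0..2 * \<kappa>}. \<rho> u s \<in> L \<longrightarrow> (u \<in> M \<longleftrightarrow> s = \<kappa>))"

lemma tube_aroundD:
  assumes "tube_around b \<kappa> L"
  shows "\<kappa> > 0" "closed L" "\<rho> b \<kappa> \<in> L"
    and "\<forall>\<^sub>F u in nhds b. \<exists>s\<in>{0..2 * \<kappa>}. \<rho> u s \<in> L"
    and "s \<in> {0..2 * \<kappa>} \<Longrightarrow> s' \<in> {0..2 * \<kappa>} \<Longrightarrow> \<rho> u s \<in> L \<Longrightarrow> \<rho> u s' \<in> L \<Longrightarrow> s = s'"
    and "s \<in> {0..2 * \<kappa>} \<Longrightarrow> \<rho> u s \<in> L \<Longrightarrow> u \<in> M \<longleftrightarrow> s = \<kappa>"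
  using assms unfolding tube_around_def by blast+

text \<open>A tube point has the unique time in \<open>{0..2 * \<kappa>}\<close> at which it reaches
  \<open>L\<close> as a coordinate. As \<open>S\<close> is both \<open>F(L, \<kappa>)\<close> and
  the part of \<open>M\<close> in the tube, the points of \<open>M\<close> there are exactly those
  of coordinate \<open>\<kappa>\<close>.\<close>

lemma tube_around_exists:
  assumes "b \<in> M"
  obtains \<kappa> L where "tube_around b \<kappa> L"
proof -
  obtain \<kappa> S L where *: "\<kappa> > 0" "closed L" "b \<in> S" "past_set \<rho> L {\<kappa>} = S"
      "b \<in> interior (past_set \<rho> L {0..2 * \<kappa>})"
      "\<forall>\<mu> \<nu>. 0 \<le> \<mu> \<and> \<mu> < \<nu> \<and> \<nu> \<le> 2 * \<kappa> \<longrightarrow> past_set \<rho> L {\<mu>} \<inter> past_set \<rho> L {\<nu>} = {}"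
      "S = M \<inter> past_set \<rho> L {0..2 * \<kappa>}"
    using STC[OF assms] unfolding satisfies_STC_def by auto
  have past_iff: "u \<in> past_set \<rho> L D \<longleftrightarrow> (\<exists>s\<in>D. \<rho> u s \<in> L)" for u D
    by (auto simp: past_set_def past_def)
  have uniq: "s = s'" if "s \<in> {0..2 * \<kappa>}" "s' \<in> {0..2 * \<kappa>}" "\<rho> u s \<in> L" "\<rho> u s' \<in> L" for u s s'
  proof (rule ccontr)
    have False if "0 \<le> a" "a < c" "c \<le> 2 * \<kappa>" "\<rho> u a \<in> L" "\<rho> u c \<in> L" for a c
      using *(6) that past_iff[of u "{a}"] past_iff[of u "{c}"] by blast
    moreover assume "s \<noteq> s'"
    ultimately show False using that by (metis atLeastAtMost_iff linorder_neqE_linordered_idom)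
  qed
  have S_iff: "u \<in> M \<longleftrightarrow> s = \<kappa>" if "s \<in> {0..2 * \<kappa>}" "\<rho> u s \<in> L" for u s
  proof -
    have "u \<in> M \<longleftrightarrow> u \<in> S"
      using *(7) that past_iff by blast
    also have "\<dots> \<longleftrightarrow> \<rho> u \<kappa> \<in> L"
      using *(4) past_iff[of u "{\<kappa>}"] by auto
    also have "\<dots> \<longleftrightarrow> s = \<kappa>"
      using that uniq[of s \<kappa> u] \<open>\<kappa> > 0\<close> by auto
    finally show ?thesis .
  qed
  have "\<rho> b \<kappa> \<in> L"
    using *(3,4) past_iff[of b "{\<kappa>}"] by auto
  moreover have "\<forall>\<^sub>F u in nhds b. \<exists>s\<in>{0..2 * \<kappa>}. \<rho> u s \<in> L"
    unfolding past_iff[symmetric] eventually_nhds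
    using *(5) interior_subset open_interior by blast
  ultimately show thesis
    by (intro that[of \<kappa> L, unfolded tube_around_def] conjI allI ballI impI *(1,2) uniq S_iff)
qed

text \<open>By uniqueness \<open>v\<close> misses \<open>L\<close> at all admissible times outside
  the open interval around \<open>s\<close>. These times form a compact set, so nearby points miss
  \<open>L\<close> there too. The point \<open>v\<close> need not be the centre
  \<open>b\<close>.\<close>

lemma eventually_tube_time_in:
  assumes tube: "tube_around b \<kappa> L" and s: "s \<in> {0..2 * \<kappa>}" "\<rho> v s \<in> L" "l < s" "s < r"
  shows "\<forall>\<^sub>F u in nhds v. \<forall>t\<in>{0..2 * \<kappa>}. \<rho> u t \<in> L \<longrightarrow> l < t \<and> t < r"
proof -
  have "\<forall>\<^sub>F u in nhds v. \<forall>t\<in>{0..2 * \<kappa>} - {l<..<r}. \<rho> u t \<notin> L"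
  proof (rule eventually_flow_avoids)
    show "compact ({0..2 * \<kappa>} - {l<..<r})"
      by (intro compact_diff) auto
    show "\<rho> v t \<notin> L" if "t \<in> {0..2 * \<kappa>} - {l<..<r}" for t
      using tube_aroundD(5)[OF tube, of t s v] that s by auto
  qed (use tube_aroundD(2)[OF tube] in auto)
  then show ?thesis
    by eventually_elim auto
qed

text \<open>Near \<open>b\<close> the tube coordinate is close to \<open>\<kappa>\<close>. Below
  \<open>\<kappa>\<close> the point has already passed \<open>M\<close> and stays off it for a
  uniform time \<open>c\<close>; above \<open>\<kappa>\<close> it hits \<open>M\<close> as soon as
  the coordinate has dropped to \<open>\<kappa>\<close>, that is, almost at once.\<close>

lemma hit_time_dichotomy:
  assumes "b \<in> M"
  obtains c where "c > 0" "ereal c < hit b" "\<rho> b c \<notin> M"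
    "\<forall>e>0. \<forall>\<^sub>F u in nhds b. u \<notin> M \<longrightarrow> ereal c < hit u \<or> hit u < ereal e"
proof -
  obtain \<kappa> L where around: "tube_around b \<kappa> L"
    using tube_around_exists[OF assms] .
  note tube = tube_aroundD[OF around]
  \<comment> \<open>Flowing for time \<open>r\<close> lowers the coordinate from \<open>s\<close> to
    \<open>s - r < \<kappa>\<close>.\<close>
  have after: "\<rho> u r \<notin> M" if "0 < r" "r \<le> s" "s \<le> \<kappa>" "\<rho> u s \<in> L" for u r s
    using tube(6)[of "s - r" "\<rho> u r"] that add[of r "s - r" u] \<open>\<kappa> > 0\<close> by auto
  show thesis
  proof (rule that; (intro allI impI)?)
    show "\<kappa> / 2 > 0" "\<rho> b (\<kappa> / 2) \<notin> M"
      using tube(1) after[of "\<kappa> / 2" \<kappa> b] tube(3) by auto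
    show "ereal (\<kappa> / 2) < hit b"
      using tube(1,3) after[of _ \<kappa> b] by (subst less_hit_time_iff) auto
    fix e :: real assume "e > 0"
    define \<eta> where "\<eta> = min (\<kappa> / 2) e"
    have \<eta>: "0 < \<eta>" "\<eta> \<le> \<kappa> / 2" "\<eta> \<le> e" using \<open>e > 0\<close> tube(1) by (auto simp: \<eta>_def)
    have "\<forall>\<^sub>F u in nhds b. \<forall>t\<in>{0..2 * \<kappa>}. \<rho> u t \<in> L \<longrightarrow> \<kappa> - \<eta> < t \<and> t < \<kappa> + \<eta>"
      by (rule eventually_tube_time_in[OF around _ tube(3)]) (use tube(1) \<eta> in auto)
    with tube(4) show "\<forall>\<^sub>F u in nhds b. u \<notin> M \<longrightarrow> ereal (\<kappa> / 2) < hit u \<or> hit u < ereal e"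
    proof eventually_elim
      case (elim u)
      then obtain s where s: "s \<in> {0..2 * \<kappa>}" "\<rho> u s \<in> L" "\<kappa> - \<eta> < s" "s < \<kappa> + \<eta>"
        by blast
      consider "s < \<kappa>" | "s = \<kappa>" | "s > \<kappa>" by linarith
      then show ?case
      proof cases
        case 1
        then have "ereal (\<kappa> / 2) < hit u"
          using s \<eta> tube(1) after[of _ s u] by (subst less_hit_time_iff) auto
        then show ?thesis by simp
      next
        case 2
        then show ?thesis using tube(6) s by blast
      next
        case 3
        then have "\<rho> (\<rho> u (s - \<kappa>)) \<kappa> \<in> L"
          using add[of "s - \<kappa>" \<kappa> u] s tube(1) by simp
        then have "\<rho> u (s - \<kappa>) \<in> M"
          using tube(6)[of \<kappa> "\<rho> u (s - \<kappa>)"] tube(1) by simp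
        then have "hit u \<le> ereal (s - \<kappa>)"
          using 3 by (intro hit_time_le) auto
        also have "\<dots> < ereal e" using s \<eta> by simp
        finally show ?thesis by simp
      qed
    qed
  qed
qed

lemma eventually_less_hit_time:
  assumes "z \<notin> M" "0 \<le> c" "ereal c < hit z"
  shows "\<forall>\<^sub>F u in nhds z. ereal c < hit u"
proof -
  have "\<forall>\<^sub>F u in nhds z. \<forall>t\<in>{0..c}. \<rho> u t \<notin> M"
  proof (rule eventually_flow_avoids)
    show "\<rho> z t \<notin> M" if "t \<in> {0..c}" for t
      using assms that less_hit_time_iff[of c z] zero by (cases "t = 0") auto
  qed (use M_closed in auto)
  then show ?thesis
    by eventually_elim (use assms in \<open>auto simp: less_hit_time_iff\<close>)
qed

text \<open>Stop at \<open>v\<close>, a small time \<open>\<delta>\<close> before the impact of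
  \<open>z\<close>, where the tube coordinate is \<open>\<kappa> + \<delta>\<close>. Points near
  \<open>v\<close> have coordinate strictly between \<open>\<kappa>\<close> and
  \<open>\<kappa> + e\<close>, so they cross \<open>M\<close> within time \<open>e\<close>.
  Continuity of the flow up to time \<open>s - \<delta>\<close> carries this back to points near
  \<open>z\<close>.\<close>

lemma eventually_hit_time_less:
  assumes "hit z = ereal s" "e > 0"
  shows "\<forall>\<^sub>F u in nhds z. hit u < ereal (s + e)"
proof -
  note s = hit_time_finite[OF assms(1)]
  obtain \<kappa> L where around: "tube_around (\<rho> z s) \<kappa> L"
    using tube_around_exists[OF s(2)] .
  note tube = tube_aroundD[OF around]
  obtain U where U: "open U" "\<rho> z s \<in> U" "\<And>u. u \<in> U \<Longrightarrow> \<exists>t\<in>{0..2 * \<kappa>}. \<rho> u t \<in> L"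
    using tube(4) unfolding eventually_nhds by blast
  have small: "\<forall>\<^sub>F \<delta> in at_right 0. \<delta> < c" if "c > 0" for c :: real
    using that by (auto simp: eventually_at_right_field)
  have "((\<lambda>\<delta>. \<rho> z (s - \<delta>)) \<longlongrightarrow> \<rho> z s) (at_right 0)"
  proof (rule tendsto_flow)
    show "((\<lambda>\<delta>. s - \<delta>) \<longlongrightarrow> s) (at_right 0)"
      by (auto intro!: tendsto_eq_intros)
    show "\<forall>\<^sub>F \<delta> in at_right 0. 0 \<le> s - \<delta>"
      using small[OF s(1)] by eventually_elim simp
  qed (use s in auto)
  then have "\<forall>\<^sub>F \<delta> in at_right 0. \<rho> z (s - \<delta>) \<in> U"
    using U by (auto dest: topological_tendstoD)
  then have "\<forall>\<^sub>F \<delta> in at_right 0. 0 < \<delta> \<and> \<delta> < s \<and> \<delta> < e \<and> \<delta> < \<kappa> \<and> \<rho> z (s - \<delta>) \<in> U"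
    using eventually_at_right_less[of 0] small[OF s(1)] small[OF assms(2)] small[OF tube(1)]
    by eventually_elim simp
  then obtain \<delta> where \<delta>: "0 < \<delta>" "\<delta> < s" "\<delta> < e" "\<delta> < \<kappa>" "\<rho> z (s - \<delta>) \<in> U"
    using eventually_happens'[OF trivial_limit_at_right_real] by blast
  define v where "v = \<rho> z (s - \<delta>)"
  have v: "\<rho> v (\<kappa> + \<delta>) \<in> L"
    using tube(1,3) \<delta> s(1) by (simp add: v_def add add.commute)
  have "\<forall>\<^sub>F u in nhds v. \<forall>t\<in>{0..2 * \<kappa>}. \<rho> u t \<in> L \<longrightarrow> \<kappa> < t \<and> t < \<kappa> + e"
    by (rule eventually_tube_time_in[OF around _ v]) (use tube(1) \<delta> in auto)
  moreover have "\<forall>\<^sub>F u in nhds v. u \<in> U"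
    using U(1) \<delta>(5) by (auto simp: v_def eventually_nhds)
  ultimately have "\<forall>\<^sub>F u in nhds v. \<exists>r\<in>{0<..<e}. \<rho> u r \<in> M"
  proof eventually_elim
    case (elim u)
    then obtain t where t: "t \<in> {0..2 * \<kappa>}" "\<rho> u t \<in> L" "\<kappa> < t" "t < \<kappa> + e"
      using U(3) by blast
    then have "\<rho> (\<rho> u (t - \<kappa>)) \<kappa> \<in> L"
      using add[of "t - \<kappa>" \<kappa> u] tube(1) by simp
    then have "\<rho> u (t - \<kappa>) \<in> M"
      using tube(6)[of \<kappa> "\<rho> u (t - \<kappa>)"] tube(1) by simp
    then show ?case
      using t by (intro bexI[of _ "t - \<kappa>"]) auto
  qed
  moreover have "filterlim (\<lambda>u. \<rho> u (s - \<delta>)) (nhds v) (nhds z)"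
    unfolding v_def by (rule tendsto_flow) (use \<delta> in \<open>auto intro: filterlim_ident\<close>)
  ultimately have "\<forall>\<^sub>F u in nhds z. \<exists>r\<in>{0<..<e}. \<rho> (\<rho> u (s - \<delta>)) r \<in> M"
    by (rule eventually_compose_filterlim)
  then show ?thesis
  proof eventually_elim
    case (elim u)
    then obtain r where r: "r \<in> {0<..<e}" "\<rho> u (s - \<delta> + r) \<in> M"
      using \<delta> by (auto simp: add)
    then have "hit u \<le> ereal (s - \<delta> + r)"
      using \<delta> by (intro hit_time_le) auto
    also have "\<dots> < ereal (s + e)" using r \<delta> by simp
    finally show ?case .
  qed
qed

lemma tendsto_hit_time:
  assumes "z \<notin> M"
  shows "(hit \<longlongrightarrow> hit z) (nhds z)"
proof (rule order_tendstoI)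
  fix a assume "a < hit z"
  show "\<forall>\<^sub>F u in nhds z. a < hit u"
  proof (cases "a < 0")
    case True
    then show ?thesis
      using less_trans[OF True hit_time_pos] by simp
  next
    case False
    then obtain c where "a = ereal c" "c \<ge> 0"
      using \<open>a < hit z\<close> by (cases a) auto
    then show ?thesis
      using eventually_less_hit_time assms \<open>a < hit z\<close> by simp
  qed
next
  fix a assume "hit z < a"
  then obtain s where s: "hit z = ereal s"
    using hit_time_pos[of z] by (cases "hit z") auto
  have "\<exists>e>0. ereal (s + e) \<le> a"
  proof (cases a)
    case (real r)
    with s \<open>hit z < a\<close> show ?thesis by (intro exI[of _ "r - s"]) simp
  qed (use s \<open>hit z < a\<close> in \<open>auto intro: exI[of _ 1]\<close>)
  then obtain e where e: "e > 0" "ereal (s + e) \<le> a" by blast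
  show "\<forall>\<^sub>F u in nhds z. hit u < a"
    using eventually_hit_time_less[OF s e(1)] by (rule eventually_mono) (rule less_le_trans[OF _ e(2)])
qed

section \<open>Joint continuity of impulsive trajectories away from impulse times\<close>

definition imp_continuous_at :: "'z \<Rightarrow> real \<Rightarrow> bool"
  where "imp_continuous_at z t \<longleftrightarrow>
    continuous (at (z, t) within UNIV \<times> {0..}) (\<lambda>(w, r). imp w r)"

lemma imp_continuous_atD:
  assumes "imp_continuous_at z t" "(u \<longlongrightarrow> z) F" "(\<tau> \<longlongrightarrow> t) F" "\<forall>\<^sub>F i in F. 0 \<le> \<tau> i"
  shows "((\<lambda>i. imp (u i) (\<tau> i)) \<longlongrightarrow> imp z t) F"
proof -
  have "((\<lambda>i. (\<lambda>(w, r). imp w r) (u i, \<tau> i)) \<longlongrightarrow> (\<lambda>(w, r). imp w r) (z, t)) F"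
    using assms
    by (intro continuous_within_tendsto_compose[OF assms(1)[unfolded imp_continuous_at_def]])
      (auto intro!: tendsto_Pair)
  then show ?thesis by simp
qed

text \<open>The index type in the assumption has to be a fixed one. The choice
  \<open>'z \<times> real\<close> suffices, because the neighbourhood filter of
  \<open>(z, t)\<close> with the two projections as nets is the case that matters.\<close>

lemma imp_continuous_atI:
  assumes "\<And>F u \<tau>. (u \<longlongrightarrow> z) F \<Longrightarrow> (\<tau> \<longlongrightarrow> t) F \<Longrightarrow> \<forall>\<^sub>F i in F. 0 \<le> \<tau> i \<Longrightarrow>
    ((\<lambda>i::'z \<times> real. imp (u i) (\<tau> i)) \<longlongrightarrow> imp z t) F"
  shows "imp_continuous_at z t"
proof -
  let ?F = "at (z, t) within UNIV \<times> {0..}"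
  have "((\<lambda>i. imp (fst i) (snd i)) \<longlongrightarrow> imp z t) ?F"
  proof (rule assms)
    show "(fst \<longlongrightarrow> z) ?F" "(snd \<longlongrightarrow> t) ?F"
      using tendsto_fst[OF tendsto_ident_at, of "(z, t)"] tendsto_snd[OF tendsto_ident_at, of "(z, t)"]
      by auto
    show "\<forall>\<^sub>F i in ?F. 0 \<le> snd i"
      unfolding eventually_at_filter by (rule always_eventually) auto
  qed
  then show ?thesis
    by (simp add: imp_continuous_at_def continuous_within case_prod_unfold)
qed

lemma tendsto_impulse_point:
  assumes "(u \<longlongrightarrow> z) F" "((\<lambda>i. hit (u i)) \<longlongrightarrow> ereal s) F" "0 \<le> s" "\<rho> z s \<in> M"
  shows "((\<lambda>i. I (\<rho> (u i) (real_of_ereal (hit (u i))))) \<longlongrightarrow> I (\<rho> z s)) F"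
    and "((\<lambda>i. real_of_ereal (hit (u i))) \<longlongrightarrow> s) F"
    and "\<forall>\<^sub>F i in F. hit (u i) = ereal (real_of_ereal (hit (u i)))"
proof -
  show fin: "\<forall>\<^sub>F i in F. hit (u i) = ereal (real_of_ereal (hit (u i)))"
    using order_tendstoD(2)[OF assms(2), of \<infinity>]
    by (auto elim!: eventually_mono simp: ereal_real less_imp_le[OF hit_time_pos])
  show lim: "((\<lambda>i. real_of_ereal (hit (u i))) \<longlongrightarrow> s) F"
    using assms(2) by (rule lim_real_of_ereal)
  have "((\<lambda>i. \<rho> (u i) (real_of_ereal (hit (u i)))) \<longlongrightarrow> \<rho> z s) F"
    using assms(1) lim
    by (rule tendsto_flow) (use assms(3) in \<open>auto intro!: always_eventually real_of_ereal_pos less_imp_le[OF hit_time_pos]\<close>)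
  moreover have "\<forall>\<^sub>F i in F. \<rho> (u i) (real_of_ereal (hit (u i))) \<in> M"
    using fin by eventually_elim (rule hit_time_finite)
  ultimately show "((\<lambda>i. I (\<rho> (u i) (real_of_ereal (hit (u i))))) \<longlongrightarrow> I (\<rho> z s)) F"
    by (rule continuous_on_tendsto_compose[OF I_cont _ assms(4)])
qed

lemma tendsto_imp_traj_past_impulse:
  assumes "(u \<longlongrightarrow> z) F" "((\<lambda>i. hit (u i)) \<longlongrightarrow> ereal s) F" "0 \<le> s" "\<rho> z s \<in> M"
    and "imp_continuous_at (I (\<rho> z s)) r" "r > 0" "(\<tau> \<longlongrightarrow> s + r) F"
  shows "((\<lambda>i. imp (u i) (\<tau> i)) \<longlongrightarrow> imp (I (\<rho> z s)) r) F"
proof -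
  define \<phi> where "\<phi> i = real_of_ereal (hit (u i))" for i
  note lims = tendsto_impulse_point[OF assms(1-4), folded \<phi>_def]
  have diff: "((\<lambda>i. \<tau> i - \<phi> i) \<longlongrightarrow> r) F"
    using tendsto_diff[OF assms(7) lims(2)] by simp
  \<comment> \<open>Because \<open>r\<close> is strictly positive, \<open>\<tau> i\<close>
    eventually exceeds the impulse time of \<open>u i\<close>, from whichever side the latter
    converges.\<close>
  then have pos: "\<forall>\<^sub>F i in F. 0 < \<tau> i - \<phi> i"
    using \<open>r > 0\<close> by (rule order_tendstoD(1))
  then have "((\<lambda>i. imp (I (\<rho> (u i) (\<phi> i))) (\<tau> i - \<phi> i)) \<longlongrightarrow> imp (I (\<rho> z s)) r) F"
    by (intro imp_continuous_atD[OF assms(5) lims(1) diff]) (auto elim: eventually_mono)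
  moreover have "\<forall>\<^sub>F i in F. imp (I (\<rho> (u i) (\<phi> i))) (\<tau> i - \<phi> i) = imp (u i) (\<tau> i)"
    using pos lims(3) by eventually_elim (rule imp_traj_after_impulse[symmetric], auto)
  ultimately show ?thesis
    by (rule Lim_transform_eventually)
qed

text \<open>After any time there is a short interval free of impulses. In stage 0 nearby points also
  stay before their first impulse. Otherwise \<open>hit\<close> is continuous at \<open>z\<close>,
  so nearby points have their first impulse close to that of \<open>z\<close>, and the induction
  hypothesis applies at the post-impulse point, which is again off \<open>M\<close>.\<close>

lemma imp_continuous_at_right:
  assumes "z \<notin> M" "0 \<le> t"
  shows "\<exists>\<delta>>0. \<forall>s. 0 < s \<and> s < \<delta> \<longrightarrow> imp_continuous_at z (t + s)"
proof -
  obtain n where "in_stage \<rho> M I z t n" using in_stageE \<open>0 \<le> t\<close> by blast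
  then show ?thesis
    using assms
  proof (induction n arbitrary: z t)
    case 0
    then have "ereal t < hit z" by (simp add: in_stage_0_iff)
    then obtain c where c: "ereal t < ereal c" "ereal c < hit z"
      using ereal_dense2 by blast
    have "imp_continuous_at z (t + s)" if s: "0 < s" "s < c - t" for s
    proof (rule imp_continuous_atI)
      fix F and u :: "'z \<times> real \<Rightarrow> 'z" and \<tau>
      assume u: "(u \<longlongrightarrow> z) F" and \<tau>: "(\<tau> \<longlongrightarrow> t + s) F" "\<forall>\<^sub>F i in F. 0 \<le> \<tau> i"
      have "\<forall>\<^sub>F i in F. ereal c < hit (u i)"
        using 0(3) c(1)
        by (intro eventually_compose_filterlim[OF eventually_less_hit_time[OF \<open>z \<notin> M\<close> _ c(2)] u]) auto
      moreover have "\<forall>\<^sub>F i in F. \<tau> i < c"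
        using \<tau>(1) s by (intro order_tendstoD) auto
      ultimately have "\<forall>\<^sub>F i in F. \<rho> (u i) (\<tau> i) = imp (u i) (\<tau> i)"
        using \<tau>(2)
      proof eventually_elim
        case (elim i)
        then have "ereal (\<tau> i) < hit (u i)"
          by (metis less_ereal.simps(1) less_trans)
        then show ?case using imp_traj_before_impulse elim by simp
      qed
      moreover have "((\<lambda>i. \<rho> (u i) (\<tau> i)) \<longlongrightarrow> \<rho> z (t + s)) F"
        using u \<tau> by (rule tendsto_flow) (use 0 s in auto)
      moreover have "ereal (t + s) < hit z"
        using s c(2) by (metis less_ereal.simps(1) less_trans less_diff_eq add.commute)
      then have "\<rho> z (t + s) = imp z (t + s)"
        using imp_traj_before_impulse 0 s by simp
      ultimately show "((\<lambda>i. imp (u i) (\<tau> i)) \<longlongrightarrow> imp z (t + s)) F"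
        by (metis Lim_transform_eventually)
    qed
    then show ?case
      using c(1) by (intro exI[of _ "c - t"]) auto
  next
    case (Suc n)
    obtain s0 where s0: "hit z = ereal s0" "s0 \<le> t"
      using hit_time_finite_if_in_stage_Suc Suc.prems(1) by blast
    note hit = hit_time_finite[OF s0(1)]
    obtain \<delta> where \<delta>: "\<delta> > 0"
      "\<And>s. 0 < s \<and> s < \<delta> \<Longrightarrow> imp_continuous_at (I (\<rho> z s0)) (t - s0 + s)"
      using Suc.IH[of "I (\<rho> z s0)" "t - s0"] Suc.prems s0 hit M_disjoint_image in_stage_Suc_iff[OF s0(1)]
      by auto
    have "imp_continuous_at z (t + s)" if s: "0 < s" "s < \<delta>" for s
    proof (rule imp_continuous_atI)
      fix F and u :: "'z \<times> real \<Rightarrow> 'z" and \<tau>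
      assume u: "(u \<longlongrightarrow> z) F" and \<tau>: "(\<tau> \<longlongrightarrow> t + s) F" "\<forall>\<^sub>F i in F. 0 \<le> \<tau> i"
      have "((\<lambda>i. hit (u i)) \<longlongrightarrow> ereal s0) F"
        using filterlim_compose[OF tendsto_hit_time[OF \<open>z \<notin> M\<close>] u] s0 by simp
      then have "((\<lambda>i. imp (u i) (\<tau> i)) \<longlongrightarrow> imp (I (\<rho> z s0)) (t - s0 + s)) F"
        by (rule tendsto_imp_traj_past_impulse[OF u]) (use hit \<delta> s s0 \<tau> in auto)
      then show "((\<lambda>i. imp (u i) (\<tau> i)) \<longlongrightarrow> imp z (t + s)) F"
        using imp_traj_after_impulse[OF s0(1), of "t + s"] s0 s by (simp add: algebra_simps)
    qed
    then show ?case
      using \<delta>(1) by blast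
  qed
qed

text \<open>When \<open>b \<in> M\<close>, the sequence \<open>u\<close> must not come from the side about to hit \<open>M\<close>: otherwise
  the trajectories, after a vanishing time, restart near \<open>I b \<noteq> b\<close>, and \<open>\<psi>\<close> would tend to \<open>I b\<close>.\<close>

lemma tendsto_imp_traj_right:
  fixes u :: "nat \<Rightarrow> 'z"
  assumes u: "u \<longlonglongrightarrow> b" "\<forall>\<^sub>F n in sequentially. u n \<notin> M"
    and \<psi>: "(\<psi> \<longlongrightarrow> b) (at_right 0)"
    and lim: "\<forall>\<^sub>F s in at_right 0. (\<lambda>n. imp (u n) s) \<longlonglongrightarrow> \<psi> s"
    and "0 \<le> t"
  shows "\<forall>\<^sub>F s in at_right 0. (\<lambda>n. imp (u n) (t + s)) \<longlonglongrightarrow> imp b (t + s)"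
proof (cases "b \<in> M")
  case False
  then obtain \<delta> where \<delta>: "\<delta> > 0" "\<And>s. 0 < s \<and> s < \<delta> \<Longrightarrow> imp_continuous_at b (t + s)"
    using imp_continuous_at_right \<open>0 \<le> t\<close> by blast
  show ?thesis
    unfolding eventually_at_right_field
    using \<delta> \<open>0 \<le> t\<close> by (intro exI[of _ \<delta>] conjI allI impI imp_continuous_atD[OF _ u(1)]) auto
next
  case True
  obtain c where c: "c > 0" "ereal c < hit b" "\<rho> b c \<notin> M"
    and dich: "\<forall>e>0. \<forall>\<^sub>F v in nhds b. v \<notin> M \<longrightarrow> ereal c < hit v \<or> hit v < ereal e"
    using hit_time_dichotomy[OF True] .
  have dich_u: "\<forall>\<^sub>F n in sequentially. ereal c < hit (u n) \<or> hit (u n) < ereal e" if "e > 0" for e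
  proof -
    have "\<forall>\<^sub>F n in sequentially. u n \<notin> M \<longrightarrow> ereal c < hit (u n) \<or> hit (u n) < ereal e"
      using dich that by (intro eventually_compose_filterlim[OF _ u(1)]) blast
    with u(2) show ?thesis by eventually_elim simp
  qed
  have after: "\<forall>\<^sub>F n in sequentially. ereal c < hit (u n)"
  proof (rule ccontr)
    assume not: "\<not> ?thesis"
    \<comment> \<open>The filter concentrates on the indices not yet past \<open>M\<close>. If
      \<open>after\<close> fails it is nontrivial, and by the dichotomy the hitting times tend to 0
      along it.\<close>
    define F where "F = inf sequentially (principal {n. \<not> ereal c < hit (u n)})"
    have "F \<noteq> bot"
      using not by (simp add: F_def trivial_limit_def eventually_inf_principal)
    have F_le: "F \<le> sequentially" by (simp add: F_def)
    have uF: "(u \<longlongrightarrow> b) F"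
      using u(1) F_le by (rule tendsto_mono[rotated])
    have "((\<lambda>n. hit (u n)) \<longlongrightarrow> ereal 0) F"
    proof (rule order_tendstoI)
      fix a assume "a < ereal 0"
      then show "\<forall>\<^sub>F n in F. a < hit (u n)"
        using less_trans[OF _ hit_time_pos] by (simp add: zero_ereal_def)
    next
      fix a assume "ereal 0 < a"
      then obtain e where "e > 0" "ereal e < a"
        using ereal_dense2 by (metis less_ereal.simps(1))
      then show "\<forall>\<^sub>F n in F. hit (u n) < a"
        using dich_u[of e] by (auto simp: F_def eventually_inf_principal elim!: eventually_mono)
    qed
    \<comment> \<open>Here the limiting impulse time is 0 and the limiting impact point is
      \<open>b\<close> itself.\<close>
    note past = tendsto_imp_traj_past_impulse[OF uF this, unfolded zero]
    have Ib: "I b \<notin> M" using True M_disjoint_image by blast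
    then obtain \<delta> where \<delta>: "\<delta> > 0" "\<And>s. 0 < s \<and> s < \<delta> \<Longrightarrow> imp_continuous_at (I b) (0 + s)"
      using imp_continuous_at_right by blast
    have "\<forall>\<^sub>F s in at_right 0. 0 < s \<and> s < \<delta>"
      using \<delta>(1) by (auto simp: eventually_at_right_field)
    with lim have "\<forall>\<^sub>F s in at_right 0. \<psi> s = imp (I b) (0 + s)"
    proof eventually_elim
      case (elim s)
      have "((\<lambda>n. imp (u n) s) \<longlongrightarrow> imp (I b) (0 + s)) F"
        using \<delta>(2)[of s] elim True by (intro past) auto
      moreover have "((\<lambda>n. imp (u n) s) \<longlongrightarrow> \<psi> s) F"
        using elim F_le tendsto_mono by blast
      ultimately show ?case
        using tendsto_unique[OF \<open>F \<noteq> bot\<close>] by blast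
    qed
    then have "((\<lambda>s. imp (I b) (0 + s)) \<longlongrightarrow> b) (at_right 0)"
      using \<psi> by (simp add: tendsto_cong)
    moreover have "((\<lambda>s. imp (I b) (0 + s)) \<longlongrightarrow> I b) (at_right 0)"
      using tendsto_at_right_imp_traj[of 0 "I b"] by (simp add: imp_traj_0)
    ultimately have "I b = b"
      using tendsto_unique[OF trivial_limit_at_right_real] by blast
    with Ib True show False by simp
  qed
  show ?thesis
  proof (cases "t < c")
    case True
    have "\<forall>\<^sub>F s in at_right 0. 0 < s \<and> t + s < c"
      unfolding eventually_at_right_field using True by (intro exI[of _ "c - t"]) auto
    then show ?thesis
    proof eventually_elim
      case (elim s)
      have before: "imp v (t + s) = \<rho> v (t + s)" if "ereal c < hit v" for v
        using elim \<open>0 \<le> t\<close> that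
        by (intro imp_traj_before_impulse) (auto intro: less_trans[of _ "ereal c"])
      have "(\<lambda>n. \<rho> (u n) (t + s)) \<longlonglongrightarrow> \<rho> b (t + s)"
        using u(1) by (rule tendsto_flow) (use elim \<open>0 \<le> t\<close> in auto)
      moreover have "\<forall>\<^sub>F n in sequentially. \<rho> (u n) (t + s) = imp (u n) (t + s)"
        using after by eventually_elim (simp add: before)
      ultimately show ?case
        unfolding before[OF c(2)] by (rule Lim_transform_eventually)
    qed
  next
    case False
    \<comment> \<open>Restarting at \<open>\<rho> b c\<close>, which is off \<open>M\<close>, makes
      joint continuity available; \<open>after\<close> ensures that the trajectories of
      \<open>u n\<close> agree with the flow up to time \<open>c\<close>.\<close>
    obtain \<delta> where \<delta>: "\<delta> > 0" "\<And>s. 0 < s \<and> s < \<delta> \<Longrightarrow> imp_continuous_at (\<rho> b c) (t - c + s)"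
      using imp_continuous_at_right[OF c(3), of "t - c"] False by auto
    have shift: "imp v (t + s) = imp (\<rho> v c) (t - c + s)" if "ereal c < hit v" "s > 0" for v s
      using imp_traj_add[of c "t - c + s" v] imp_traj_before_impulse[of c v] that c(1) False by simp
    have "\<forall>\<^sub>F s in at_right 0. 0 < s \<and> s < \<delta>"
      using \<delta>(1) by (auto simp: eventually_at_right_field)
    then show ?thesis
    proof eventually_elim
      case (elim s)
      have "(\<lambda>n. \<rho> (u n) c) \<longlonglongrightarrow> \<rho> b c"
        using u(1) by (rule tendsto_flow) (use c in auto)
      then have "(\<lambda>n. imp (\<rho> (u n) c) (t - c + s)) \<longlonglongrightarrow> imp (\<rho> b c) (t - c + s)"
        by (rule imp_continuous_atD[OF \<delta>(2)[OF elim]]) (use elim False in auto)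
      moreover have "\<forall>\<^sub>F n in sequentially. imp (\<rho> (u n) c) (t - c + s) = imp (u n) (t + s)"
        using after by eventually_elim (use elim in \<open>simp add: shift\<close>)
      ultimately show ?case
        using shift[OF c(2)] elim by (simp add: Lim_transform_eventually)
    qed
  qed
qed

end

section \<open>Conjugacy on the limit set and the equivalence\<close>

lemma limit_set_eq:
  "limit_set \<rho> M I z = {q. convergence_times (imp_traj \<rho> M I z) q \<noteq> {}}"
  by (auto simp: limit_set_def convergence_times_def)

lemma conv_seqs_to_eq: "conv_seqs_to \<rho> M I z = convergence_times (imp_traj \<rho> M I z)"
  by (auto simp: fun_eq_iff conv_seqs_to_def convergence_times_def)

lemma comparison_conjugacy:
  fixes \<pi> :: "'x::metric_space \<Rightarrow> real \<Rightarrow> 'x" and \<sigma> :: "'y::metric_space \<Rightarrow> real \<Rightarrow> 'y"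
    and MX IX MY IY
  defines "f \<equiv> imp_traj \<pi> MX IX" and "k \<equiv> imp_traj \<sigma> MY IY"
  assumes "standing_ISS \<pi> MX IX" "standing_ISS \<sigma> MY IY" "limit_comparison (f x) (k y) h"
    and q: "convergence_times (f x) q \<noteq> {}" "q \<notin> MX" and t: "0 \<le> t"
  shows "convergence_times (f x) (f q t) \<noteq> {}" and "h (f q t) = k (h q) t"
proof -
  interpret X: standing_ISS \<pi> MX IX by fact
  interpret Y: standing_ISS \<sigma> MY IY by fact
  interpret limit_comparison "f x" "k y" h by fact
  let ?L = "{p. convergence_times (f x) p \<noteq> {}}"
  obtain \<tau> where \<tau>: "\<tau> \<in> convergence_times (f x) q"
    using q by blast
  then have \<tau>': "\<And>n. 0 \<le> \<tau> n" "filterlim \<tau> at_top sequentially" "(\<lambda>n. f x (\<tau> n)) \<longlonglongrightarrow> q"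
    by (auto simp: convergence_times_def)
  \<comment> \<open>A general base time \<open>r\<close> is kept, because the fact is needed both at
    \<open>r = 0\<close>, to control the behaviour at \<open>h q\<close>, and at
    \<open>r = t\<close>.\<close>
  have shifted: "\<forall>\<^sub>F s in at_right 0. 0 < s \<and> (\<lambda>n. \<tau> n + (r + s)) \<in> convergence_times (f x) (f q (r + s))"
    if "0 \<le> r" for r
  proof -
    obtain \<delta> where \<delta>: "\<delta> > 0" "\<And>s. 0 < s \<and> s < \<delta> \<Longrightarrow> X.imp_continuous_at q (r + s)"
      using X.imp_continuous_at_right[OF q(2) \<open>0 \<le> r\<close>] by blast
    have "(\<lambda>n. \<tau> n + (r + s)) \<in> convergence_times (f x) (f q (r + s))" if s: "0 < s" "s < \<delta>" for s
    proof -
      have "(\<lambda>n. f (f x (\<tau> n)) (r + s)) \<longlonglongrightarrow> f q (r + s)"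
        unfolding f_def
        by (rule X.imp_continuous_atD) (use \<delta> s \<tau>'(3) \<open>0 \<le> r\<close> in \<open>auto simp: f_def\<close>)
      moreover have "f (f x (\<tau> n)) (r + s) = f x (\<tau> n + (r + s))" for n
        unfolding f_def using \<tau>'(1) s \<open>0 \<le> r\<close> by (intro X.imp_traj_add) auto
      moreover have "filterlim (\<lambda>n. \<tau> n + (r + s)) at_top sequentially"
        using \<tau>'(2) s \<open>0 \<le> r\<close> by (intro filterlim_at_top_mono[OF \<tau>'(2)]) auto
      ultimately show ?thesis
        using \<tau>'(1) s \<open>0 \<le> r\<close> by (simp add: convergence_times_def)
    qed
    then show ?thesis
      unfolding eventually_at_right_field using \<delta>(1) by blast
  qed
  have rlim: "((\<lambda>s. f q (r + s)) \<longlongrightarrow> f q r) (at_right 0)" if "0 \<le> r" for r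
    unfolding f_def using that by (rule X.tendsto_at_right_imp_traj)
  have evL: "\<forall>\<^sub>F s in at_right 0. f q (r + s) \<in> ?L" if "0 \<le> r" for r
    using shifted[OF that] by eventually_elim auto
  \<comment> \<open>At \<open>r\<close> itself an impulse may occur, so membership is obtained from
    times just after \<open>r\<close> by closedness.\<close>
  have L: "f q r \<in> ?L" if "0 \<le> r" for r
    using Lim_in_closed_set[OF closed_limit_points evL[OF that] trivial_limit_at_right_real rlim[OF that]] .
  then show "convergence_times (f x) (f q t) \<noteq> {}"
    using t by simp
  have hlim: "((\<lambda>s. h (f q (r + s))) \<longlongrightarrow> h (f q r)) (at_right 0)" if "0 \<le> r" for r
    using continuous_on_tendsto_compose[OF continuous_on_limit_points rlim[OF that] L[OF that] evL[OF that]] .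
  have klim: "\<forall>\<^sub>F s in at_right 0. (\<lambda>n. k (k y (\<tau> n)) (r + s)) \<longlonglongrightarrow> h (f q (r + s))" if "0 \<le> r" for r
    using shifted[OF that]
  proof eventually_elim
    case (elim s)
    then have "(\<lambda>n. k y (\<tau> n + (r + s))) \<longlonglongrightarrow> h (f q (r + s))"
      using times_subset by (fastforce simp: convergence_times_def)
    moreover have "k (k y (\<tau> n)) (r + s) = k y (\<tau> n + (r + s))" for n
      unfolding k_def using \<tau>'(1) elim \<open>0 \<le> r\<close> by (intro Y.imp_traj_add) auto
    ultimately show ?case by simp
  qed
  have "\<forall>\<^sub>F s in at_right 0. (\<lambda>n. k (k y (\<tau> n)) (t + s)) \<longlonglongrightarrow> k (h q) (t + s)"
    unfolding k_def
  \<comment> \<open>Continuity of \<open>h\<close> makes this \<open>\<psi>\<close> tend to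
    \<open>h q\<close>, which rules out an approach from the side about to hit
    \<open>MY\<close>.\<close>
  proof (rule Y.tendsto_imp_traj_right[where \<psi> = "\<lambda>s. h (f q (0 + s))"])
    show "(\<lambda>n. imp_traj \<sigma> MY IY y (\<tau> n)) \<longlonglongrightarrow> h q"
      using \<tau> times_subset by (auto simp: convergence_times_def k_def)
    \<comment> \<open>At time 0 the point \<open>y\<close> may lie in \<open>MY\<close>; at positive
      times its trajectory cannot.\<close>
    have "\<forall>\<^sub>F n in sequentially. 0 < \<tau> n"
      using \<tau>'(2) by (simp add: filterlim_at_top_dense)
    then show "\<forall>\<^sub>F n in sequentially. imp_traj \<sigma> MY IY y (\<tau> n) \<notin> MY"
      by eventually_elim (simp add: Y.imp_traj_notin_M)
    show "((\<lambda>s. h (f q (0 + s))) \<longlongrightarrow> h q) (at_right 0)"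
      using hlim[of 0] by (simp add: f_def X.imp_traj_0)
    show "\<forall>\<^sub>F s in at_right 0. (\<lambda>n. imp_traj \<sigma> MY IY (imp_traj \<sigma> MY IY y (\<tau> n)) s) \<longlonglongrightarrow> h (f q (0 + s))"
      using klim[of 0] by (simp add: k_def)
  qed (rule t)
  with klim[OF t] have "\<forall>\<^sub>F s in at_right 0. h (f q (t + s)) = k (h q) (t + s)"
    by eventually_elim (rule LIMSEQ_unique)
  then have "((\<lambda>s. k (h q) (t + s)) \<longlongrightarrow> h (f q t)) (at_right 0)"
    using hlim[OF t] by (simp add: tendsto_cong)
  moreover have "((\<lambda>s. k (h q) (t + s)) \<longlongrightarrow> k (h q) t) (at_right 0)"
    unfolding k_def using t by (rule Y.tendsto_at_right_imp_traj)
  ultimately show "h (f q t) = k (h q) t"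
    by (rule tendsto_unique[OF trivial_limit_at_right_real])
qed

theorem corollary4p18:
  fixes \<pi> :: "'x::metric_space \<Rightarrow> real \<Rightarrow> 'x" and MX :: "'x set" and IX :: "'x \<Rightarrow> 'x"
    and \<sigma> :: "'y::metric_space \<Rightarrow> real \<Rightarrow> 'y" and MY :: "'y set" and IY :: "'y \<Rightarrow> 'y"
    and x :: 'x and y :: 'y and g :: "'x \<Rightarrow> real \<Rightarrow> real"
  assumes "standing_ISS \<pi> MX IX"
    and "standing_ISS \<sigma> MY IY"
    and "asymp_almost_periodic \<pi> MX IX x"
    and "compact (closure (imp_orbit \<pi> MX IX x))"
    and "\<And>z. z \<in> asymp_recurrent_set \<pi> MX IX x \<Longrightarrow> asymptotic_via \<pi> MX IX x z (g z)"
  shows "comparable_in_limit \<sigma> MY IY y \<pi> MX IX x \<longleftrightarrow>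
    (\<exists>h. continuous_on (limit_set \<pi> MX IX x) h
       \<and> h ` limit_set \<pi> MX IX x \<subseteq> limit_set \<sigma> MY IY y
       \<and> (\<forall>q \<in> limit_set \<pi> MX IX x.
             conv_seqs_to \<pi> MX IX x q \<subseteq> conv_seqs_to \<sigma> MY IY y (h q))
       \<and> (\<forall>q \<in> limit_set \<pi> MX IX x - MX. \<forall>t\<ge>0.
             h (imp_traj \<pi> MX IX q t) = imp_traj \<sigma> MY IY (h q) t)
       \<and> (\<forall>q \<in> asymp_recurrent_set \<pi> MX IX x - MX.
             ((\<lambda>t. dist (imp_traj \<sigma> MY IY y t) (imp_traj \<sigma> MY IY (h q) (g q t))) \<longlongrightarrow> 0) at_top))"
    (is "?cmp \<longleftrightarrow> (\<exists>h. ?P h)")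
proof
  assume "\<exists>h. ?P h"
  then obtain h where h: "\<forall>q\<in>limit_set \<pi> MX IX x. conv_seqs_to \<pi> MX IX x q \<subseteq> conv_seqs_to \<sigma> MY IY y (h q)"
    by blast
  have "conv_seqs_to \<pi> MX IX x q \<subseteq> conv_seqs \<sigma> MY IY y" for q
  \<comment> \<open>A nonempty set of convergence times places \<open>q\<close> in the limit set,
    where the inclusion for \<open>h\<close> is available.\<close>
  proof (cases "conv_seqs_to \<pi> MX IX x q = {}")
    case False
    then have "q \<in> limit_set \<pi> MX IX x"
      by (simp add: limit_set_eq conv_seqs_to_eq)
    with h show ?thesis
      unfolding conv_seqs_def by blast
  qed simp
  then show ?cmp
    unfolding comparable_in_limit_def conv_seqs_def[of \<pi>] by blast
next
  let ?f = "imp_traj \<pi> MX IX" and ?k = "imp_traj \<sigma> MY IY"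
  assume ?cmp
  then have "(\<Union>q. convergence_times (?f x) q) \<subseteq> (\<Union>p. convergence_times (?k y) p)"
    by (simp add: comparable_in_limit_def conv_seqs_def conv_seqs_to_eq)
  then obtain h where h: "\<And>q. convergence_times (?f x) q \<subseteq> convergence_times (?k y) (h q)"
    using comparison_map_exists by blast
  then interpret limit_comparison "?f x" "?k y" h
    by unfold_locales
  note conj = comparison_conjugacy[OF assms(1,2) limit_comparison_axioms]
  have asym: "((\<lambda>t. dist (?k y t) (?k (h q) (g q t))) \<longlongrightarrow> 0) at_top"
    if q: "q \<in> asymp_recurrent_set \<pi> MX IX x - MX" for q
  proof -
    have q': "convergence_times (?f x) q \<noteq> {}" "q \<notin> MX"
      using q by (auto simp: asymp_recurrent_set_def limit_set_eq)
    have via: "asymptotic_via \<pi> MX IX x q (g q)"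
      using assms(5) q by blast
    then obtain g' where "homeomorphism {0..} {0..} (g q) g'"
      by (auto simp: asymptotic_via_def time_reparam_def)
    then have g: "0 \<le> g q t" if "0 \<le> t" for t
      using that by (auto simp: homeomorphism_def)
    have "((\<lambda>t. dist (?k y t) (h (?f q (g q t)))) \<longlongrightarrow> 0) at_top"
    \<comment> \<open>The comparison trajectory is that of \<open>q\<close> under
      \<open>g q\<close>; it stays in the limit set by the first part of the conjugacy
      lemma.\<close>
    proof (rule asymptotic_comparison[OF assms(4)])
      show "?f x t \<in> closure (imp_orbit \<pi> MX IX x)" if "0 \<le> t" for t
        using that closure_subset by (force simp: imp_orbit_def)
      show "convergence_times (?f x) (?f q (g q t)) \<noteq> {}" if "0 \<le> t" for t
        using conj(1)[OF q' g[OF that]] .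
      show "((\<lambda>t. dist (?f x t) (?f q (g q t))) \<longlongrightarrow> 0) at_top"
        using via by (simp add: asymptotic_via_def)
    qed
    moreover have "\<forall>\<^sub>F t in at_top. dist (?k y t) (h (?f q (g q t))) = dist (?k y t) (?k (h q) (g q t))"
      using eventually_ge_at_top[of 0] by eventually_elim (simp add: conj(2)[OF q' g])
    ultimately show ?thesis
      by (rule Lim_transform_eventually)
  qed
  show "\<exists>h. ?P h"
  proof (intro exI[of _ h] conjI ballI allI impI)
    show "continuous_on (limit_set \<pi> MX IX x) h"
      unfolding limit_set_eq by (rule continuous_on_limit_points)
    show "h ` limit_set \<pi> MX IX x \<subseteq> limit_set \<sigma> MY IY y"
      using h by (auto simp: limit_set_eq)
    show "conv_seqs_to \<pi> MX IX x q \<subseteq> conv_seqs_to \<sigma> MY IY y (h q)" for q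
      unfolding conv_seqs_to_eq by (rule h)
    show "h (?f q t) = ?k (h q) t" if "q \<in> limit_set \<pi> MX IX x - MX" "0 \<le> t" for q t
      using conj(2)[OF _ _ that(2)] that(1) by (simp add: limit_set_eq)
  qed (rule asym)
qed


end
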